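(* Let $n\ge 2$, let $\delta,\tau,\gamma\in(0,1)$ and $1\le s\le \frac{n}{n-\delta}$. Let $\Omega\subset\mathbb{R}^n$ be an $s$-distance John domain with John constant $C_J\ge 1$. Then there exists a constant $C>0$ depending only on $n,\tau,s,\gamma,C_J$ and $\operatorname{diam}\Omega$ such that for every Lebesgue measurable set $U\subset\Omega$ with $|U|/|\Omega|\le\gamma$ one can find a set $\mathcal{N}_U$ of Lebesgue measure zero and a covering $\{B(x_i,r_i)\}_{i=1}^\infty$ of $U\setminus\mathcal{N}_U$ for which $$\sum_{i=1}^\infty r_i^{s(n-\delta)}\le C(1-\delta)\,\mathcal{P}_{\delta,\tau}(U,\Omega).$$ If $U$ is an open set, then one can take $\mathcal{N}_U=\emptyset$.
   Context: A domain is a nonempty open connected set; $d(x)=\operatorname{dist}(x,\partial\Omega)$; $|U|$ is Lebesgue measure; $B(x,r)$ is the open ball. Coverings by balls are at most countable (possibly finite or empty; equivalently, $r_i\ge 0$ with $B(x,0)=\emptyset$). A bounded domain $\Omega\subset\mathbb{R}^n$ is an $s$-distance John domain ($s\ge1$) with John constant $C_J\ge 1$ and John center $x_J\in\Omega$ if each $x\in\Omega$ can be joined to $x_J$ by a rectifiable curve $\gamma:[0,1]\to\Omega$, $\gamma(0)=x$, $\gamma(1)=x_J$, with $C_J\, d(\gamma(t))>|\gamma(t)-x|^s$ for all $t\in[0,1]$. For a measurable $U\subset\Omega$, $$\mathcal{P}_{\delta,\tau}(U,\Omega):=\int_\Omega\int_{\{x\in\Omega:\,|x-y|<\tau d(y)\}}\frac{|\chi_U(x)-\chi_U(y)|}{|x-y|^{n+\delta}}\,dx\,dy\in[0,\infty].$$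 *)

theory Defs
  imports "HOL-Analysis.Analysis"
begin

definition rectifiable :: "(real \<Rightarrow> 'a::metric_space) \<Rightarrow> bool" where
  "rectifiable \<gamma> \<longleftrightarrow> path \<gamma> \<and>
    (\<exists>L. \<forall>m (t :: nat \<Rightarrow> real). mono_on {..m} t \<and> t ` {..m} \<subseteq> {0..1} \<longrightarrow>
       (\<Sum>i<m. dist (\<gamma> (t i)) (\<gamma> (t (Suc i)))) \<le> L)"

text \<open>The frontier of a bounded domain is nonempty, so the convention
  \<^term>\<open>infdist x {} = 0\<close> plays no role below.\<close>

definition bdist :: "'a::metric_space set \<Rightarrow> 'a \<Rightarrow> real" where
  "bdist \<Omega> x = infdist x (frontier \<Omega>)"

definition is_domain :: "'a::topological_space set \<Rightarrow> bool" where
  "is_domain \<Omega> \<longleftrightarrow> \<Omega> \<noteq> {} \<and> open \<Omega> \<and> connected \<Omega>"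

definition distance_John_domain :: "real \<Rightarrow> real \<Rightarrow> 'a::euclidean_space \<Rightarrow> 'a set \<Rightarrow> bool" where
  "distance_John_domain s C\<^sub>J x\<^sub>J \<Omega> \<longleftrightarrow>
     s \<ge> 1 \<and> C\<^sub>J \<ge> 1 \<and> is_domain \<Omega> \<and> bounded \<Omega> \<and> x\<^sub>J \<in> \<Omega> \<and>
     (\<forall>x\<in>\<Omega>. \<exists>\<gamma>. rectifiable \<gamma> \<and> path_image \<gamma> \<subseteq> \<Omega> \<and> pathstart \<gamma> = x \<and> pathfinish \<gamma> = x\<^sub>J \<and>
        (\<forall>t\<in>{0..1}. C\<^sub>J * bdist \<Omega> (\<gamma> t) > norm (\<gamma> t - x) powr s))"

text \<open>On the diagonal \<open>x = y\<close> the integrand is \<open>0 / 0 = 0\<close>. Integration is over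
  \<^term>\<open>lebesgue\<close> rather than \<^term>\<open>lborel\<close> because \<open>U\<close> is only Lebesgue measurable.\<close>

definition fractional_perimeter ::
  "real \<Rightarrow> real \<Rightarrow> (real ^ 'n) set \<Rightarrow> (real ^ 'n) set \<Rightarrow> ennreal" where
  "fractional_perimeter \<delta> \<tau> U \<Omega> =
     (\<integral>\<^sup>+ y \<in> \<Omega>. (\<integral>\<^sup>+ x \<in> {x \<in> \<Omega>. norm (x - y) < \<tau> * bdist \<Omega> y}.
         ennreal (\<bar>indicator U x - indicator U y\<bar> / norm (x - y) powr (real CARD('n) + \<delta>))
       \<partial>lebesgue) \<partial>lebesgue)"

end

theory Submission
  imports Defs
begin

text \<open>Let \<open>\<rho>(z) = \<tau> d(z) / 4\<close>. Call a ball \<open>B(z, \<rho>)\<close> with \<open>\<rho> \<le> \<rho>(z)\<close> a half ball if \<open>U\<close> fills exactly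
  half of it. A half ball satisfies \<open>\<rho>\<^sup>n\<^sup>-\<^sup>\<delta> \<le> C (1 - \<delta>) E\<close>, where \<open>E\<close> is the part of the perimeter
  integral over \<open>B \<times> B\<close>. Indeed, splitting a segment at its midpoint shows that halving the scale
  of the pairs \<open>(x, y)\<close> divides the number of jumps by at most \<open>2\<^sup>n\<^sup>+\<^sup>1\<close>; summing over all dyadic
  scales gives a geometric series with sum at least \<open>1 / (1 - \<delta>)\<close>.

  Around a density point \<open>x\<close> of \<open>U\<close> small balls are more than half full. If \<open>B(x\<^sub>J, \<rho>(x\<^sub>J))\<close> is at most
  half full, the intermediate value theorem applied first to the radius at \<open>x\<close> and then along the
  John curve yields a half ball \<open>B(z, \<rho>)\<close> with \<open>|x - z|\<^sup>s \<le> C \<rho>\<close>. A Vitali selection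
  among the balls \<open>B(z, C \<rho>\<^sup>1\<^sup>/\<^sup>s)\<close> then gives the covering. If \<open>B(x\<^sub>J, \<rho>(x\<^sub>J))\<close> is more than half full,
  the same argument covers \<open>\<Omega> - U\<close>. As \<open>s (n - \<delta>) \<le> n\<close>, the measure of \<open>\<Omega> - U\<close>, which is at least
  \<open>(1 - \<gamma>) |\<Omega>|\<close>, is controlled by the perimeter, so that a single ball containing \<open>\<Omega>\<close> suffices.\<close>

section \<open>Jumps at dyadic scales\<close>

definition jump :: "'a set \<Rightarrow> 'a \<Rightarrow> 'a \<Rightarrow> ennreal" where
  "jump U x y = ennreal \<bar>indicator U x - indicator U y\<bar>"

lemma jump_commute: "jump U x y = jump U y x"
  by (simp add: jump_def abs_minus_commute)

lemma jump_triangle: "jump U x z \<le> jump U x y + jump U y z"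
  by (auto simp: jump_def indicator_def simp flip: ennreal_plus)

lemma borel_measurable_jump [measurable (raw)]:
  assumes "U \<in> sets borel" "f \<in> measurable M borel" "g \<in> measurable M borel"
  shows "(\<lambda>x. jump U (f x) (g x)) \<in> borel_measurable M"
  using assms unfolding jump_def by measurable

lemma nn_integral_lborel_affine:
  fixes f :: "'a::euclidean_space \<Rightarrow> ennreal"
  assumes [measurable]: "f \<in> borel_measurable borel" and c: "c > 0"
  shows "(\<integral>\<^sup>+x. f x \<partial>lborel) = ennreal (c ^ DIM('a)) * (\<integral>\<^sup>+x. f (t + c *\<^sub>R x) \<partial>lborel)"
proof -
  have "(\<integral>\<^sup>+x. f x \<partial>lborel)
      = (\<integral>\<^sup>+x. f x \<partial>density (distr lborel borel (\<lambda>x. t + c *\<^sub>R x)) (\<lambda>_. ennreal (\<bar>c\<bar> ^ DIM('a))))"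
    using lborel_affine[of c t] c by simp
  also have "\<dots> = (\<integral>\<^sup>+x. ennreal (c ^ DIM('a)) * f (t + c *\<^sub>R x) \<partial>lborel)"
    using c by (subst nn_integral_density) (auto simp: nn_integral_distr)
  also have "\<dots> = ennreal (c ^ DIM('a)) * (\<integral>\<^sup>+x. f (t + c *\<^sub>R x) \<partial>lborel)"
    by (rule nn_integral_cmult) measurable
  finally show ?thesis .
qed

definition pair_jump :: "'a::euclidean_space set \<Rightarrow> 'a set \<Rightarrow> real \<Rightarrow> 'a \<Rightarrow> 'a \<Rightarrow> ennreal" where
  "pair_jump U B a x y = jump U x y * indicator B x * indicator B y * indicator {..<a} (norm (x - y))"

lemma borel_measurable_pair_jump [measurable (raw)]:
  assumes [measurable]: "U \<in> sets borel" "B \<in> sets borel" "f \<in> measurable M borel" "g \<in> measurable M borel"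
  shows "(\<lambda>x. pair_jump U B a (f x) (g x)) \<in> borel_measurable M"
  unfolding pair_jump_def by measurable

text \<open>If \<open>U\<close> separates x from y, it separates their midpoint from one of them,
  and convexity keeps the midpoint in \<open>B\<close>. The two halves of the segment give a factor
  2; substituting the midpoint for y gives the factor \<open>2 ^ DIM('a)\<close>.\<close>

lemma pair_jump_halving:
  fixes U B :: "'a::euclidean_space set"
  assumes [measurable]: "U \<in> sets borel" "B \<in> sets borel" and "convex B"
  shows "(\<integral>\<^sup>+x. \<integral>\<^sup>+y. pair_jump U B a x y \<partial>lborel \<partial>lborel)
    \<le> ennreal (2 ^ (DIM('a) + 1)) * (\<integral>\<^sup>+x. \<integral>\<^sup>+y. pair_jump U B (a / 2) x y \<partial>lborel \<partial>lborel)"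
proof -
  define m :: "'a \<Rightarrow> 'a \<Rightarrow> 'a" where "m x y = (1/2) *\<^sub>R x + (1/2) *\<^sub>R y" for x y
  have [measurable (raw)]: "(\<lambda>z. m (f z) (g z)) \<in> borel_measurable M"
    if "f \<in> borel_measurable M" "g \<in> borel_measurable M" for f g and M :: "'z measure"
    using that unfolding m_def by measurable
  \<comment> \<open>With \<open>m y x\<close> in the second term, that term is the first one with x
    and y exchanged, so Fubini gives both the same integral \<open>J\<close>.\<close>
  have le: "pair_jump U B a x y \<le> pair_jump U B (a/2) x (m x y) + pair_jump U B (a/2) y (m y x)" for x y
  proof (cases "x \<in> B \<and> y \<in> B \<and> norm (x - y) < a")
    case True
    have mB: "m x y \<in> B"
      using True \<open>convex B\<close> unfolding m_def convex_def by auto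
    have mc: "m y x = m x y" by (simp add: m_def add.commute)
    have "x - m x y = (1/2) *\<^sub>R (x - y)" "y - m x y = (1/2) *\<^sub>R (y - x)"
      by (simp_all add: m_def algebra_simps flip: scaleR_left.add)
    then have "norm (x - m x y) < a / 2" "norm (y - m x y) < a / 2"
      using True by (simp_all add: norm_minus_commute)
    then show ?thesis
      using True mB jump_triangle[of U x y "m x y"] by (simp add: pair_jump_def mc jump_commute)
  next
    case False
    then show ?thesis by (auto simp: pair_jump_def)
  qed
  define J where "J = (\<integral>\<^sup>+x. \<integral>\<^sup>+y. pair_jump U B (a/2) x (m x y) \<partial>lborel \<partial>lborel)"
  have "(\<integral>\<^sup>+x. \<integral>\<^sup>+y. pair_jump U B a x y \<partial>lborel \<partial>lborel)
      \<le> (\<integral>\<^sup>+x. \<integral>\<^sup>+y. pair_jump U B (a/2) x (m x y) + pair_jump U B (a/2) y (m y x) \<partial>lborel \<partial>lborel)"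
    by (intro nn_integral_mono le)
  also have "\<dots> = J + (\<integral>\<^sup>+x. \<integral>\<^sup>+y. pair_jump U B (a/2) y (m y x) \<partial>lborel \<partial>lborel)"
    unfolding J_def by (simp add: nn_integral_add)
  also have "(\<integral>\<^sup>+x. \<integral>\<^sup>+y. pair_jump U B (a/2) y (m y x) \<partial>lborel \<partial>lborel) = J"
    unfolding J_def by (rule lborel_pair.Fubini') measurable
  finally have 1: "(\<integral>\<^sup>+x. \<integral>\<^sup>+y. pair_jump U B a x y \<partial>lborel \<partial>lborel) \<le> 2 * J"
    by (simp add: mult_2)
  have 2: "(\<integral>\<^sup>+y. pair_jump U B (a/2) x (m x y) \<partial>lborel)
      = ennreal (2 ^ DIM('a)) * (\<integral>\<^sup>+y. pair_jump U B (a/2) x y \<partial>lborel)" for x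
    by (subst nn_integral_lborel_affine[where c = "1/2" and t = "(1/2) *\<^sub>R x"])
       (simp_all add: m_def power_one_over mult.assoc[symmetric] flip: ennreal_mult)
  have "J = ennreal (2 ^ DIM('a)) * (\<integral>\<^sup>+x. \<integral>\<^sup>+y. pair_jump U B (a / 2) x y \<partial>lborel \<partial>lborel)"
    unfolding J_def 2 by (rule nn_integral_cmult) measurable
  moreover have "2 * ennreal (2 ^ DIM('a)) = ennreal (2 ^ (DIM('a) + 1))"
    by (simp add: ennreal_mult flip: ennreal_numeral)
  ultimately show ?thesis
    using 1 by (simp add: mult.assoc[symmetric])
qed

lemma pair_jump_halving_iterate:
  fixes U B :: "'a::euclidean_space set"
  assumes "U \<in> sets borel" "B \<in> sets borel" "convex B"
  shows "(\<integral>\<^sup>+x. \<integral>\<^sup>+y. pair_jump U B a x y \<partial>lborel \<partial>lborel)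
    \<le> ennreal (2 ^ ((DIM('a) + 1) * k)) * (\<integral>\<^sup>+x. \<integral>\<^sup>+y. pair_jump U B (a / 2 ^ k) x y \<partial>lborel \<partial>lborel)"
proof (induction k)
  case (Suc k)
  have "ennreal (2 ^ ((DIM('a) + 1) * k)) * (\<integral>\<^sup>+x. \<integral>\<^sup>+y. pair_jump U B (a / 2 ^ k) x y \<partial>lborel \<partial>lborel)
    \<le> ennreal (2 ^ ((DIM('a) + 1) * k)) * (ennreal (2 ^ (DIM('a) + 1)) *
        (\<integral>\<^sup>+x. \<integral>\<^sup>+y. pair_jump U B (a / 2 ^ k / 2) x y \<partial>lborel \<partial>lborel))"
    by (intro mult_left_mono pair_jump_halving assms) auto
  also have "\<dots> = ennreal (2 ^ ((DIM('a) + 1) * Suc k)) *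
      (\<integral>\<^sup>+x. \<integral>\<^sup>+y. pair_jump U B (a / 2 ^ Suc k) x y \<partial>lborel \<partial>lborel)"
  proof -
    have "ennreal (2 ^ ((DIM('a) + 1) * k)) * ennreal (2 ^ (DIM('a) + 1)) = ennreal (2 ^ ((DIM('a) + 1) * Suc k))"
      unfolding ennreal_mult[symmetric, OF zero_le_power[OF zero_le_numeral] zero_le_power[OF zero_le_numeral]]
        power_add[symmetric] by (simp only: mult_Suc_right add.commute)
    then show ?thesis by (simp only: mult.assoc[symmetric] divide_divide_eq_left power_Suc2)
  qed
  finally show ?case using Suc by (rule order_trans[rotated])
qed simp

text \<open>A geometric sum whose ratio \<open>2 powr p\<close> is at least 2 is at most twice its
  last term, and the last \<open>2 ^ k\<close> that counts is below \<open>v\<close>.\<close>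

lemma sum_dyadic_le:
  fixes p v :: real
  assumes "p \<ge> 1" "v > 0"
  shows "(\<Sum>k<N. 2 powr (p * real k) * indicator {..<v} (2 ^ k)) \<le> 2 * v powr p"
proof (induction N)
  case (Suc N)
  show ?case
  proof (cases "2 ^ N < v")
    case True
    have q: "2 powr p \<ge> (2::real)"
      using powr_mono[of 1 p 2] assms by simp
    have geo: "(\<Sum>k<M. (2 powr p) ^ k) \<le> (2 powr p) ^ M" for M
    proof (induction M)
      case (Suc M)
      have "(\<Sum>k<Suc M. (2 powr p) ^ k) \<le> (2 powr p) ^ M + (2 powr p) ^ M" using Suc by simp
      also have "\<dots> = 2 * (2 powr p) ^ M" by simp
      also have "\<dots> \<le> 2 powr p * (2 powr p) ^ M" using q by (intro mult_right_mono) auto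
      finally show ?case by simp
    qed simp
    have e: "2 powr (p * real k) = (2 powr p) ^ k" for k
      by (simp add: powr_powr flip: powr_realpow)
    have "(\<Sum>k<Suc N. 2 powr (p * real k) * indicator {..<v} (2 ^ k)) \<le> (\<Sum>k<Suc N. (2 powr p) ^ k)"
      unfolding e by (intro sum_mono) (auto simp: indicator_def)
    also have "\<dots> \<le> 2 * (2 powr p) ^ N" using geo[of N] by simp
    also have "(2 powr p) ^ N = (2 ^ N) powr p"
      by (simp add: powr_powr mult.commute flip: powr_realpow)
    also have "\<dots> \<le> v powr p" using True assms by (intro powr_mono2) auto
    finally show ?thesis by simp
  next
    case False
    then show ?thesis using Suc by simp
  qed
qed simp

text \<open>The source of the factor 1 - \<delta> in the theorem: the ratio is
  \<open>b = 2 powr - (1 - d)\<close>, and 1 - b \<le> (1 - d) ln 2 \<le> 1 - d by convexity of the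
  exponential.\<close>

lemma suminf_geometric_ge:
  fixes d :: real
  assumes "0 < d" "d < 1"
  shows "ennreal (1 / (1 - d)) \<le> (\<Sum>k. ennreal (2 powr - ((1 - d) * real k)))"
proof -
  define b :: real where "b = 2 powr - (1 - d)"
  have b: "0 < b" "b < 1"
    using assms unfolding b_def by (auto simp: powr_less_one)
  have "2 powr - ((1 - d) * real k) = b ^ k" for k
    unfolding b_def by (simp add: powr_powr algebra_simps flip: powr_realpow)
  then have "(\<Sum>k. ennreal (2 powr - ((1 - d) * real k))) = ennreal (1 / (1 - b))"
    using b by (simp add: suminf_ennreal2 summable_geometric suminf_geometric)
  moreover have "1 - b \<le> 1 - d"
  proof -
    have "1 + (- (1 - d) * ln 2) \<le> exp (- (1 - d) * ln 2)" by (rule exp_ge_add_one_self)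
    also have "\<dots> = b" by (simp add: b_def powr_def)
    finally have "1 - (1 - d) * ln 2 \<le> b" by (simp add: algebra_simps)
    moreover have "(1 - d) * ln 2 \<le> (1 - d) * 1"
      using assms ln_2_less_1 by (intro mult_left_mono) auto
    ultimately show ?thesis by simp
  qed
  then have "1 / (1 - d) \<le> 1 / (1 - b)"
    using assms b by (intro divide_left_mono) auto
  ultimately show ?thesis
    by (simp add: ennreal_leI)
qed

text \<open>For a small enough ball \<open>B\<close> inside \<Omega>, the share of the perimeter
  integral that falls to \<open>B\<close>; the exponent \<open>p\<close> will be the dimension plus
  \<delta>.\<close>

definition energy :: "real \<Rightarrow> 'a::euclidean_space set \<Rightarrow> 'a set \<Rightarrow> ennreal" where
  "energy p U B = (\<integral>\<^sup>+y. \<integral>\<^sup>+x. ennreal (\<bar>indicator U x - indicator U y\<bar> / norm (x - y) powr p)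
     * indicator B x * indicator B y \<partial>lborel \<partial>lborel)"

text \<open>A separated pair in \<open>B\<close> is present at scale k exactly when
  \<open>2 ^ k\<close> is below \<open>v = a / norm (x - y)\<close>, so its weights add up to at
  most \<open>2 * v powr p\<close>, a multiple of the perimeter kernel.\<close>

lemma suminf_pair_jump_le:
  fixes U B :: "'a::euclidean_space set"
  assumes "p \<ge> 1" "a > 0"
  shows "(\<Sum>k. ennreal (2 powr (p * real k)) * pair_jump U B (a / 2 ^ k) x y)
    \<le> ennreal (2 * a powr p) * (ennreal (\<bar>indicator U x - indicator U y\<bar> / norm (x - y) powr p)
         * indicator B x * indicator B y)"
proof (cases "x \<in> B \<and> y \<in> B \<and> (x \<in> U) \<noteq> (y \<in> U)")
  case True
  then have "x \<noteq> y" by auto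
  then have u: "norm (x - y) > 0" by simp
  have 1: "jump U x y = 1" "\<bar>indicator U x - indicator U y :: real\<bar> = 1"
    using True by (auto simp: jump_def)
  define v where "v = a / norm (x - y)"
  have "v > 0" using u assms by (simp add: v_def)
  have eq: "ennreal (2 powr (p * real k)) * pair_jump U B (a / 2 ^ k) x y
      = ennreal (2 powr (p * real k) * indicator {..<v} (2 ^ k))" for k
    using True 1 u by (auto simp: pair_jump_def indicator_def v_def field_simps)
  have "(\<Sum>k. ennreal (2 powr (p * real k) * indicator {..<v} (2 ^ k))) \<le> ennreal (2 * v powr p)"
  proof (rule suminf_le_const)
    fix N
    have "(\<Sum>k<N. ennreal (2 powr (p * real k) * indicator {..<v} (2 ^ k)))
        = ennreal (\<Sum>k<N. 2 powr (p * real k) * indicator {..<v} (2 ^ k))"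
      by (rule sum_ennreal) auto
    also have "\<dots> \<le> ennreal (2 * v powr p)"
      by (intro ennreal_leI sum_dyadic_le assms \<open>v > 0\<close>)
    finally show "(\<Sum>k<N. ennreal (2 powr (p * real k) * indicator {..<v} (2 ^ k))) \<le> ennreal (2 * v powr p)" .
  qed auto
  also have "2 * v powr p = 2 * a powr p * (1 / norm (x - y) powr p)"
    using u assms by (simp add: v_def powr_divide)
  finally show ?thesis
    using True 1(2) by (simp only: eq) (simp flip: ennreal_mult)
next
  case False
  then have "pair_jump U B (a / 2 ^ k) x y = 0" for k
    by (auto simp: pair_jump_def jump_def indicator_def)
  then show ?thesis by simp
qed

text \<open>With \<open>p = DIM('a) + d\<close>, the k-fold halving estimate multiplied by
  \<open>2 powr - ((1 - d) * k)\<close> carries exactly the weight \<open>2 powr (p * k)\<close> on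
  its right side. Summing over k gives a factor of at least 1 / (1 - d) on the left and at most a
  multiple of the energy on the right.\<close>

lemma jump_integral_le_energy:
  fixes U B :: "'a::euclidean_space set" and a d :: real
  assumes [measurable]: "U \<in> sets borel" "B \<in> sets borel"
    and "convex B" and a: "a > 0" "\<And>x y. x \<in> B \<Longrightarrow> y \<in> B \<Longrightarrow> norm (x - y) < a"
    and d: "0 < d" "d < 1"
  shows "(\<integral>\<^sup>+y. \<integral>\<^sup>+x. jump U y x * indicator B x * indicator B y \<partial>lborel \<partial>lborel)
    \<le> ennreal (2 * a powr (DIM('a) + d) * (1 - d)) * energy (DIM('a) + d) U B"
proof -
  define p where "p = real DIM('a) + d"
  have "p \<ge> 1" using d DIM_positive[where 'a='a] unfolding p_def by linarith
  define T where "T k = (\<integral>\<^sup>+x. \<integral>\<^sup>+y. pair_jump U B (a / 2 ^ k) x y \<partial>lborel \<partial>lborel)" for k :: nat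
  define T0 where "T0 = (\<integral>\<^sup>+x. \<integral>\<^sup>+y. pair_jump U B a x y \<partial>lborel \<partial>lborel)"
  \<comment> \<open>All distances in \<open>B\<close> are below \<open>a\<close>, so the truncation
    at scale \<open>a\<close> removes nothing.\<close>
  have T0: "T0 = (\<integral>\<^sup>+y. \<integral>\<^sup>+x. jump U y x * indicator B x * indicator B y \<partial>lborel \<partial>lborel)"
    unfolding T0_def by (intro nn_integral_cong) (auto simp: pair_jump_def indicator_def a)
  have "ennreal (2 powr - ((1 - d) * real k)) * T0 \<le> ennreal (2 powr (p * real k)) * T k" for k
  proof -
    have "ennreal (2 powr - ((1 - d) * real k)) * T0
        \<le> ennreal (2 powr - ((1 - d) * real k)) * (ennreal (2 ^ ((DIM('a) + 1) * k)) * T k)"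
      unfolding T_def T0_def by (intro mult_left_mono pair_jump_halving_iterate assms) auto
    also have "\<dots> = ennreal (2 powr - ((1 - d) * real k) * 2 powr real ((DIM('a) + 1) * k)) * T k"
      by (subst powr_realpow) (simp_all add: ennreal_mult mult.assoc)
    also have "2 powr - ((1 - d) * real k) * 2 powr real ((DIM('a) + 1) * k) = 2 powr (p * real k)"
      by (simp add: p_def algebra_simps flip: powr_add)
    finally show ?thesis .
  qed
  then have "(\<Sum>k. ennreal (2 powr - ((1 - d) * real k)) * T0) \<le> (\<Sum>k. ennreal (2 powr (p * real k)) * T k)"
    by (intro suminf_le) auto
  also have "\<dots> = (\<integral>\<^sup>+x. \<integral>\<^sup>+y. (\<Sum>k. ennreal (2 powr (p * real k)) * pair_jump U B (a / 2 ^ k) x y) \<partial>lborel \<partial>lborel)"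
    unfolding T_def by (simp add: nn_integral_suminf nn_integral_cmult)
  also have "\<dots> \<le> (\<integral>\<^sup>+x. \<integral>\<^sup>+y. ennreal (2 * a powr p) * (ennreal (\<bar>indicator U x - indicator U y\<bar> / norm (x - y) powr p)
         * indicator B x * indicator B y) \<partial>lborel \<partial>lborel)"
    by (intro nn_integral_mono suminf_pair_jump_le \<open>p \<ge> 1\<close> a)
  also have "\<dots> = ennreal (2 * a powr p) * energy p U B"
  proof -
    define g where "g x y = ennreal (\<bar>indicator U x - indicator U y\<bar> / norm (x - y) powr p)
         * indicator B x * indicator B y" for x y
    have [measurable (raw)]: "(\<lambda>z. g (f z) (h z)) \<in> borel_measurable M"
      if "f \<in> borel_measurable M" "h \<in> borel_measurable M" for f h and M :: "'z measure"
      using that unfolding g_def by measurable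
    \<comment> \<open>Symmetry adapts the order of integration to \<open>energy\<close>, where the
      first argument is the inner variable.\<close>
    have g: "g x y = g y x" for x y
      by (simp add: g_def norm_minus_commute abs_minus_commute mult_ac)
    have "(\<integral>\<^sup>+x. \<integral>\<^sup>+y. ennreal (2 * a powr p) * g x y \<partial>lborel \<partial>lborel)
        = ennreal (2 * a powr p) * (\<integral>\<^sup>+x. \<integral>\<^sup>+y. g x y \<partial>lborel \<partial>lborel)"
      by (simp add: nn_integral_cmult)
    also have "(\<integral>\<^sup>+x. \<integral>\<^sup>+y. g x y \<partial>lborel \<partial>lborel) = (\<integral>\<^sup>+x. \<integral>\<^sup>+y. g y x \<partial>lborel \<partial>lborel)"
      by (subst g) (rule refl)
    finally show ?thesis unfolding energy_def g_def .
  qed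
  finally have le: "(\<Sum>k. ennreal (2 powr - ((1 - d) * real k))) * T0 \<le> ennreal (2 * a powr p) * energy p U B"
    unfolding ennreal_suminf_multc .
  have "T0 = ennreal (1 - d) * (ennreal (1 / (1 - d)) * T0)"
    using d by (simp add: mult.assoc[symmetric] flip: ennreal_mult)
  also have "\<dots> \<le> ennreal (1 - d) * ((\<Sum>k. ennreal (2 powr - ((1 - d) * real k))) * T0)"
    by (intro mult_left_mono mult_right_mono suminf_geometric_ge d) auto
  also have "\<dots> \<le> ennreal (1 - d) * (ennreal (2 * a powr p) * energy p U B)"
    by (intro mult_left_mono le) auto
  also have "\<dots> = ennreal (2 * a powr p * (1 - d)) * energy p U B"
    using d by (simp add: mult.assoc[symmetric] mult.commute flip: ennreal_mult)
  finally show ?thesis unfolding T0 p_def .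
qed

text \<open>A separated pair has one point in \<open>U\<close> and one outside; its two orders give
  the factor 2.\<close>

lemma jump_integral_eq:
  fixes U B :: "'a::euclidean_space set"
  assumes [measurable]: "U \<in> sets borel" "B \<in> sets borel"
  shows "2 * emeasure lborel (U \<inter> B) * emeasure lborel (B - U)
    = (\<integral>\<^sup>+y. \<integral>\<^sup>+x. jump U y x * indicator B x * indicator B y \<partial>lborel \<partial>lborel)"
proof -
  have "(\<integral>\<^sup>+y. \<integral>\<^sup>+x. jump U y x * indicator B x * indicator B y \<partial>lborel \<partial>lborel)
     = (\<integral>\<^sup>+y. \<integral>\<^sup>+x. indicator (U \<inter> B) y * indicator (B - U) x + indicator (B - U) y * indicator (U \<inter> B) x \<partial>lborel \<partial>lborel)"
    by (intro nn_integral_cong) (auto simp: jump_def indicator_def)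
  also have "\<dots> = 2 * emeasure lborel (U \<inter> B) * emeasure lborel (B - U)"
    by (simp add: nn_integral_add nn_integral_cmult nn_integral_multc mult_2 distrib_left distrib_right mult.commute)
  finally show ?thesis ..
qed

text \<open>This is \<open>4 * 2 powr (n + d) / w\<^sup>2\<close> with \<open>d\<close> raised to 1,
  which removes the dependence on \<delta>; here n is the dimension and w the volume of the unit
  ball.\<close>

definition half_ball_const :: "'a::euclidean_space itself \<Rightarrow> real" where
  "half_ball_const _ = 2 ^ (DIM('a) + 3) / (unit_ball_vol DIM('a))\<^sup>2"

lemma half_ball_const_pos: "half_ball_const TYPE('a::euclidean_space) > 0"
  unfolding half_ball_const_def
  by (intro divide_pos_pos zero_less_power unit_ball_vol_pos) auto

text \<open>In a half ball the separated pairs have measure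
  \<open>w\<^sup>2 * r ^ (2 * n) / 2\<close>, while \<open>jump_integral_le_energy\<close> with
  \<open>a = 2 * r\<close> costs a multiple of \<open>r powr (n + d)\<close>. The quotient leaves
  \<open>r powr (n - d)\<close>.\<close>

lemma half_ball_energy:
  fixes U :: "'a::euclidean_space set" and d r :: real
  assumes [measurable]: "U \<in> sets borel" and r: "r > 0"
    and half: "2 * measure lborel (U \<inter> ball z r) = unit_ball_vol DIM('a) * r ^ DIM('a)"
    and d: "0 < d" "d < 1"
  shows "ennreal (r powr (DIM('a) - d))
    \<le> ennreal (half_ball_const TYPE('a) * (1 - d)) * energy (DIM('a) + d) U (ball z r)"
proof -
  let ?B = "ball z r" and ?n = "DIM('a)"
  define w where "w = unit_ball_vol ?n"
  have "w > 0" by (simp add: w_def)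
  have fin: "emeasure lborel (U \<inter> ?B) \<noteq> \<infinity>" "emeasure lborel ?B \<noteq> \<infinity>"
    using emeasure_mono[of "U \<inter> ?B" ?B lborel] emeasure_lborel_ball_finite[of z r] by (auto simp: top_unique)
  have m1: "measure lborel (U \<inter> ?B) = w * r ^ ?n / 2" using half by (simp add: w_def)
  have mB: "measure lborel ?B = w * r ^ ?n" using r by (simp add: w_def content_ball)
  have "measure lborel (?B - (U \<inter> ?B)) = measure lborel ?B - measure lborel (U \<inter> ?B)"
    using fin by (intro measure_Diff) auto
  then have m2: "measure lborel (?B - U) = w * r ^ ?n / 2"
    using m1 mB by (simp add: Diff_Int)
  have e1: "emeasure lborel (U \<inter> ?B) = ennreal (w * r ^ ?n / 2)"
    using fin emeasure_eq_ennreal_measure[of lborel "U \<inter> ?B"] unfolding m1 by simp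
  have fin3: "emeasure lborel (?B - U) \<noteq> \<infinity>"
    using emeasure_mono[of "?B - U" ?B lborel] fin by (auto simp: top_unique)
  have e2: "emeasure lborel (?B - U) = ennreal (w * r ^ ?n / 2)"
    using fin3 emeasure_eq_ennreal_measure[of lborel "?B - U"] unfolding m2 by simp
  have dist: "norm (x - y) < 2 * r" if "x \<in> ?B" "y \<in> ?B" for x y
    using that dist_triangle_half_l[of x z "2 * r" y] by (auto simp: dist_norm norm_minus_commute)
  have "2 * ennreal (w * r ^ ?n / 2) * ennreal (w * r ^ ?n / 2)
     \<le> ennreal (2 * (2 * r) powr (?n + d) * (1 - d)) * energy (?n + d) U ?B"
    using jump_integral_eq[of U ?B] jump_integral_le_energy[of U ?B "2 * r" d, OF _ _ _ _ dist] r d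
    by (simp add: e1 e2)
  also have "2 * ennreal (w * r ^ ?n / 2) * ennreal (w * r ^ ?n / 2) = ennreal (w\<^sup>2 * r ^ (2 * ?n) / 2)"
  proof -
    define q where "q = w * r ^ ?n / 2"
    have "q \<ge> 0" using \<open>w > 0\<close> r by (simp add: q_def)
    then have "2 * ennreal q * ennreal q = ennreal (2 * q * q)"
      by (simp add: ennreal_mult)
    also have "2 * q * q = w\<^sup>2 * (r ^ ?n * r ^ ?n) / 2"
      by (simp add: q_def power2_eq_square)
    finally show ?thesis unfolding q_def mult_2 power_add .
  qed
  finally have le: "ennreal (w\<^sup>2 * r ^ (2 * ?n) / 2) \<le> ennreal (2 * (2 * r) powr (?n + d) * (1 - d)) * energy (?n + d) U ?B" .
  define c where "c = 2 / (w\<^sup>2 * r powr (?n + d))"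
  have "c > 0" using \<open>w > 0\<close> r by (simp add: c_def)
  have rr: "r ^ (2 * ?n) = r powr (?n + d) * r powr (?n - d)"
    using r by (simp flip: powr_add powr_realpow)
  have "r powr (?n - d) = c * (w\<^sup>2 * r ^ (2 * ?n) / 2)"
    unfolding rr using \<open>w > 0\<close> r by (simp add: c_def field_simps)
  then have "ennreal (r powr (?n - d)) = ennreal c * ennreal (w\<^sup>2 * r ^ (2 * ?n) / 2)"
    using \<open>c > 0\<close> \<open>w > 0\<close> r by (simp flip: ennreal_mult)
  also have "\<dots> \<le> ennreal c * (ennreal (2 * (2 * r) powr (?n + d) * (1 - d)) * energy (?n + d) U ?B)"
    by (intro mult_left_mono le) auto
  also have "\<dots> = ennreal (c * (2 * (2 * r) powr (?n + d) * (1 - d))) * energy (?n + d) U ?B"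
    using \<open>c > 0\<close> d r by (simp add: ennreal_mult mult.assoc)
  also have "\<dots> \<le> ennreal (half_ball_const TYPE('a) * (1 - d)) * energy (?n + d) U ?B"
  proof (intro mult_right_mono ennreal_leI)
    have "c * (2 * (2 * r) powr (?n + d) * (1 - d)) = 4 * 2 powr (?n + d) / w\<^sup>2 * (1 - d)"
      using r \<open>w > 0\<close> by (simp add: c_def powr_mult field_simps)
    also have "\<dots> \<le> 4 * 2 powr (?n + 1) / w\<^sup>2 * (1 - d)"
      using d \<open>w > 0\<close> by (intro mult_right_mono divide_right_mono mult_left_mono powr_mono) auto
    also have "4 * 2 powr (?n + 1) / w\<^sup>2 = half_ball_const TYPE('a)"
      using powr_realpow[of 2 "?n + 1"] by (simp add: half_ball_const_def w_def power_add)
    finally show "c * (2 * (2 * r) powr (?n + d) * (1 - d)) \<le> half_ball_const TYPE('a) * (1 - d)" .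
  qed auto
  finally show ?thesis .
qed

section \<open>Density and covering\<close>

text \<open>The new ball lies in \<open>ball z (r + e)\<close>, so whatever it gains lies in the
  shell between the radii \<open>r\<close> and \<open>r + e\<close>.\<close>

lemma measure_Int_ball_le:
  fixes U :: "'a::euclidean_space set"
  assumes [measurable]: "U \<in> sets borel" and r: "r \<ge> 0" and e: "dist z z' + \<bar>r' - r\<bar> \<le> e"
  shows "measure lborel (U \<inter> ball z' r')
    \<le> measure lborel (U \<inter> ball z r) + unit_ball_vol DIM('a) * ((r + e) ^ DIM('a) - r ^ DIM('a))"
proof -
  have "e \<ge> 0" using e zero_le_dist[of z z'] by linarith
  have sub: "U \<inter> ball z' r' \<subseteq> (U \<inter> ball z r) \<union> (ball z (r + e) - ball z r)"
  proof
    fix y assume y: "y \<in> U \<inter> ball z' r'"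
    then have "dist z y < r + e"
      using dist_triangle[of z y z'] e by (auto simp: dist_commute)
    then show "y \<in> (U \<inter> ball z r) \<union> (ball z (r + e) - ball z r)" using y by auto
  qed
  have fm: "ball z a \<in> fmeasurable lborel" for z :: 'a and a
    by (intro fmeasurableI emeasure_lborel_ball_finite) auto
  have fm2: "U \<inter> ball z r \<in> fmeasurable lborel"
    by (rule fmeasurableI2[OF fm[of z r]]) auto
  have fm3: "ball z (r + e) - ball z r \<in> fmeasurable lborel"
    by (intro fmeasurable.Diff fm)
  have "measure lborel (U \<inter> ball z' r') \<le> measure lborel ((U \<inter> ball z r) \<union> (ball z (r + e) - ball z r))"
    by (rule measure_mono_fmeasurable[OF sub]) (auto intro: fmeasurable.Un fm2 fm3)
  also have "\<dots> \<le> measure lborel (U \<inter> ball z r) + measure lborel (ball z (r + e) - ball z r)"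
    using fm2 fm3 by (intro measure_Un_le) auto
  also have "measure lborel (ball z (r + e) - ball z r) = measure lborel (ball z (r + e)) - measure lborel (ball z r)"
    using \<open>e \<ge> 0\<close> fm[of z "r + e"] fm[of z r]
    by (intro measure_Diff) (auto dest: fmeasurableD2)
  also have "\<dots> = unit_ball_vol DIM('a) * ((r + e) ^ DIM('a) - r ^ DIM('a))"
    using \<open>e \<ge> 0\<close> r by (simp add: content_ball algebra_simps)
  finally show ?thesis by simp
qed

text \<open>\<open>measure_Int_ball_le\<close> in both directions bounds the change by two shell
  volumes, added up in \<open>g\<close>. The continuity serves the intermediate value theorem and
  the closedness of sets of thin points.\<close>

lemma continuous_on_measure_Int_ball:
  fixes U :: "'a::euclidean_space set" and c :: "'b::topological_space \<Rightarrow> 'a"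
  assumes U: "U \<in> sets borel" and c: "continuous_on S c" and r: "continuous_on S r" "\<And>t. t \<in> S \<Longrightarrow> r t \<ge> 0"
  shows "continuous_on S (\<lambda>t. measure lborel (U \<inter> ball (c t) (r t)))"
  unfolding continuous_on_def
proof
  fix t0 assume t0: "t0 \<in> S"
  define f where "f t = measure lborel (U \<inter> ball (c t) (r t))" for t
  define e where "e t = dist (c t) (c t0) + \<bar>r t - r t0\<bar>" for t
  define g where "g t = unit_ball_vol DIM('a) * ((r t0 + e t) ^ DIM('a) - r t0 ^ DIM('a))
    + unit_ball_vol DIM('a) * ((r t + e t) ^ DIM('a) - r t ^ DIM('a))" for t
  have ct: "(c \<longlongrightarrow> c t0) (at t0 within S)" "(r \<longlongrightarrow> r t0) (at t0 within S)"
    using c r t0 by (auto simp: continuous_on_def)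
  have e0: "(e \<longlongrightarrow> 0) (at t0 within S)"
  proof -
    have "(e \<longlongrightarrow> dist (c t0) (c t0) + \<bar>r t0 - r t0\<bar>) (at t0 within S)"
      unfolding e_def by (intro tendsto_intros ct)
    then show ?thesis by simp
  qed
  have "(g \<longlongrightarrow> unit_ball_vol DIM('a) * ((r t0 + 0) ^ DIM('a) - r t0 ^ DIM('a))
    + unit_ball_vol DIM('a) * ((r t0 + 0) ^ DIM('a) - r t0 ^ DIM('a))) (at t0 within S)"
    unfolding g_def by (intro tendsto_intros ct e0)
  then have g0: "(g \<longlongrightarrow> 0) (at t0 within S)" by simp
  have "((\<lambda>t. f t - f t0) \<longlongrightarrow> 0) (at t0 within S)"
  proof (rule Lim_null_comparison[OF _ g0])
    have "norm (f t - f t0) \<le> g t" if "t \<in> S" for t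
    proof -
      have nn: "r t0 \<ge> 0" "r t \<ge> 0" "e t \<ge> 0" using r t0 that by (auto simp: e_def)
      have 1: "f t \<le> f t0 + unit_ball_vol DIM('a) * ((r t0 + e t) ^ DIM('a) - r t0 ^ DIM('a))"
        unfolding f_def by (rule measure_Int_ball_le[OF U nn(1)]) (simp add: e_def dist_commute)
      have 2: "f t0 \<le> f t + unit_ball_vol DIM('a) * ((r t + e t) ^ DIM('a) - r t ^ DIM('a))"
        unfolding f_def by (rule measure_Int_ball_le[OF U nn(2)]) (simp add: e_def)
      have 3: "unit_ball_vol DIM('a) * ((a + e t) ^ DIM('a) - a ^ DIM('a)) \<ge> 0" if "a \<ge> 0" for a
        using that nn by (simp add: power_mono less_imp_le)
      show ?thesis using 1 2 3[OF nn(1)] 3[OF nn(2)] by (simp add: g_def)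
    qed
    then show "\<forall>\<^sub>F t in at t0 within S. norm (f t - f t0) \<le> g t"
      by (auto simp: eventually_at_filter)
  qed
  then show "((\<lambda>t. measure lborel (U \<inter> ball (c t) (r t))) \<longlongrightarrow> measure lborel (U \<inter> ball (c t0) (r t0))) (at t0 within S)"
    unfolding f_def by (rule LIM_zero_cancel)
qed

text \<open>Weaker than being a point of density: one suitable radius below each bound is enough to
  start the intermediate value argument.\<close>

definition thick_at :: "'a::euclidean_space set \<Rightarrow> 'a \<Rightarrow> bool" where
  "thick_at V x \<longleftrightarrow> (\<forall>e>0. \<exists>r. 0 < r \<and> r < e \<and>
     unit_ball_vol DIM('a) * r ^ DIM('a) \<le> 2 * measure lborel (V \<inter> ball x r))"

text \<open>Small balls lie inside \<open>V\<close>. This is why an open \<open>U\<close> has an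
  empty exceptional set.\<close>

lemma thick_at_open:
  fixes V :: "'a::euclidean_space set"
  assumes "open V" "x \<in> V"
  shows "thick_at V x"
  unfolding thick_at_def
proof (intro allI impI)
  fix e :: real assume "e > 0"
  obtain d where d: "d > 0" "ball x d \<subseteq> V" using assms open_contains_ball by blast
  define r where "r = min d e / 2"
  have r: "0 < r" "r < e" "r < d" using d \<open>e > 0\<close> by (auto simp: r_def)
  have "V \<inter> ball x r = ball x r" using d r by auto
  moreover have "unit_ball_vol DIM('a) * r ^ DIM('a) \<ge> 0" using r by simp
  ultimately show "\<exists>r. 0 < r \<and> r < e \<and> unit_ball_vol DIM('a) * r ^ DIM('a) \<le> 2 * measure lborel (V \<inter> ball x r)"
    using r by (intro exI[of _ r]) (simp add: content_ball)
qed

text \<open>A half of the Lebesgue density theorem: a set of small density at each of its points loses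
  at least half of its measure when intersected with a Vitali family.\<close>

lemma null_sets_thin_points:
  fixes V :: "'a::euclidean_space set"
  assumes V [measurable]: "V \<in> sets borel"
  shows "{x \<in> V. \<not> thick_at V x} \<in> null_sets lebesgue"
proof -
  let ?w = "unit_ball_vol DIM('a)"
  \<comment> \<open>\<open>F k\<close> fixes one range of radii for all its points, which makes it
    closed and hence Borel. The ball of radius \<open>k\<close> in \<open>A k\<close> keeps the
    measure finite for the cancellation below.\<close>
  define F where "F k = (\<Inter>r\<in>{0<..<1 / real (Suc k)}. {x. 2 * measure lborel (V \<inter> ball x r) \<le> ?w * r ^ DIM('a)})" for k
  define A where "A k = V \<inter> ball 0 (real k) \<inter> F k" for k
  have "closed (F k)" for k
    unfolding F_def
    by (intro closed_INT ballI closed_Collect_le continuous_intros continuous_on_measure_Int_ball V) auto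
  then have A [measurable]: "A k \<in> sets borel" for k unfolding A_def by measurable
  have A0: "emeasure lborel (A k) = 0" for k
  proof -
    have fin: "emeasure lborel (A k) < \<infinity>"
      using emeasure_mono[of "A k" "ball 0 (real k)" lborel] emeasure_lborel_ball_finite[of 0 "real k"]
      unfolding A_def by (auto intro: le_less_trans)
    have le: "emeasure lborel (A k) \<le> ennreal e" if e: "e > 0" for e
    proof -
      have AL: "A k \<in> sets lebesgue" by simp
      obtain T where T: "open T" "A k \<subseteq> T" "emeasure lebesgue (T - A k) < ennreal e"
        using sets_lebesgue_outer_open[OF AL e] by metis
      define K where "K = {(x, r). x \<in> A k \<and> 0 < r \<and> r < 1 / real (Suc k) \<and> ball x r \<subseteq> T}"
      obtain C where C: "countable C" "C \<subseteq> K"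
        "pairwise (\<lambda>i j. disjnt (ball (fst i) (snd i)) (ball (fst j) (snd j))) C"
        "negligible (A k - (\<Union>i \<in> C. ball (fst i) (snd i)))"
      proof (rule Vitali_covering_theorem_balls[of "A k" K fst snd])
        fix x and d :: real assume x: "x \<in> A k" and "0 < d"
        obtain e' where e': "e' > 0" "ball x e' \<subseteq> T" using T x open_contains_ball by blast
        define m where "m = min e' (min d (1 / real (Suc k)))"
        have m: "0 < m" "m \<le> e'" "m \<le> d" "m \<le> 1 / real (Suc k)"
          using e' \<open>d > 0\<close> by (auto simp: m_def)
        define r where "r = m / 2"
        have r: "0 < r" "r < e'" "r < d" "r < 1 / real (Suc k)"
          using m unfolding r_def by linarith+
        have "(x, r) \<in> K" using x r e' by (auto simp: K_def)
        then show "\<exists>i. i \<in> K \<and> x \<in> ball (fst i) (snd i) \<and> snd i < d"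
          using r by (intro exI[of _ "(x, r)"]) auto
      qed
      have disj: "disjoint_family_on (\<lambda>i. X \<inter> ball (fst i) (snd i)) C" for X
        using C(3) unfolding disjoint_family_on_def pairwise_def disjnt_def by blast
      have [measurable]: "(\<Union>i \<in> C. ball (fst i) (snd i)) \<in> sets borel"
        by (intro borel_open open_UN) auto
      have "A k - (\<Union>i \<in> C. ball (fst i) (snd i)) \<in> sets lborel"
        by measurable
      with C(4) have "A k - (\<Union>i \<in> C. ball (fst i) (snd i)) \<in> null_sets lborel"
        by (simp only: negligible_iff_null_sets null_sets_completion_iff)
      then have "emeasure lborel (A k) = emeasure lborel (A k - (A k - (\<Union>i \<in> C. ball (fst i) (snd i))))"
        by (rule emeasure_Diff_null_set[symmetric]) measurable
      also have "\<dots> \<le> emeasure lborel (\<Union>i\<in>C. V \<inter> ball (fst i) (snd i))"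
        by (intro emeasure_mono) (auto simp: A_def)
      also have "\<dots> = (\<integral>\<^sup>+i. emeasure lborel (V \<inter> ball (fst i) (snd i)) \<partial>count_space C)"
        using C(1) disj[of V] by (intro emeasure_UN_countable) auto
      \<comment> \<open>Each ball is centred in \<open>A k\<close>, so \<open>V\<close> fills at
        most half of it. Hence twice the measure of \<open>A k\<close> is at most that of
        \<open>T\<close>, and cancelling one copy leaves at most \<open>e\<close>.\<close>
      finally have "2 * emeasure lborel (A k) \<le> 2 * (\<integral>\<^sup>+i. emeasure lborel (V \<inter> ball (fst i) (snd i)) \<partial>count_space C)"
        by (intro mult_left_mono) auto
      also have "\<dots> = (\<integral>\<^sup>+i. 2 * emeasure lborel (V \<inter> ball (fst i) (snd i)) \<partial>count_space C)"
        by (rule nn_integral_cmult[symmetric]) auto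
      also have "\<dots> \<le> (\<integral>\<^sup>+i. emeasure lborel (ball (fst i) (snd i)) \<partial>count_space C)"
      proof (intro nn_integral_mono)
        fix i assume "i \<in> space (count_space C)"
        then have i: "i \<in> K" using C by auto
        obtain x r where xr: "i = (x, r)" by (cases i)
        have r: "0 < r" "2 * measure lborel (V \<inter> ball x r) \<le> ?w * r ^ DIM('a)"
          using i by (auto simp: K_def A_def F_def xr)
        have "emeasure lborel (V \<inter> ball x r) < \<infinity>"
          using emeasure_mono[of "V \<inter> ball x r" "ball x r" lborel] emeasure_lborel_ball_finite[of x r]
          by (auto simp: le_less_trans)
        then have "2 * emeasure lborel (V \<inter> ball x r) = ennreal (2 * measure lborel (V \<inter> ball x r))"
          by (subst emeasure_eq_ennreal_measure) (auto simp: ennreal_mult)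
        also have "\<dots> \<le> emeasure lborel (ball x r)"
          using r by (simp add: emeasure_ball ennreal_leI)
        finally show "2 * emeasure lborel (V \<inter> ball (fst i) (snd i)) \<le> emeasure lborel (ball (fst i) (snd i))"
          by (simp add: xr)
      qed
      also have "\<dots> = emeasure lborel (\<Union>i\<in>C. ball (fst i) (snd i))"
        using C(1) disj[of UNIV] by (intro emeasure_UN_countable[symmetric]) auto
      also have "\<dots> \<le> emeasure lborel T"
      proof (rule emeasure_mono)
        have "ball (fst i) (snd i) \<subseteq> T" if "i \<in> C" for i
          using subsetD[OF C(2) that] by (simp add: K_def split_beta)
        then show "(\<Union>i\<in>C. ball (fst i) (snd i)) \<subseteq> T" by blast
      qed (use T in auto)
      also have "\<dots> = emeasure lborel (A k \<union> (T - A k))"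
        using T by (simp add: Un_absorb1)
      also have "\<dots> \<le> emeasure lborel (A k) + emeasure lborel (T - A k)"
        using T by (intro emeasure_subadditive) auto
      also have "\<dots> \<le> emeasure lborel (A k) + ennreal e"
        using T by (intro add_left_mono) (simp add: less_imp_le)
      finally show ?thesis
        using fin by (auto simp: mult_2)
    qed
    have "emeasure lborel (A k) \<le> 0"
    proof (rule ennreal_le_epsilon)
      show "emeasure lborel (A k) \<le> 0 + ennreal e" if "0 < e" for e
        using le[OF that] by simp
    qed
    then show ?thesis by simp
  qed
  have "(\<Union>k. A k) \<in> null_sets lborel"
    by (intro null_sets_UN) (auto simp: A0 null_sets_def)
  moreover have "{x \<in> V. \<not> thick_at V x} \<subseteq> (\<Union>k. A k)"
  proof
    fix x assume "x \<in> {x \<in> V. \<not> thick_at V x}"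
    then obtain e where x: "x \<in> V" and "e > 0"
      and e: "\<And>r. 0 < r \<Longrightarrow> r < e \<Longrightarrow> 2 * measure lborel (V \<inter> ball x r) < ?w * r ^ DIM('a)"
      unfolding thick_at_def by (auto simp: not_le)
    obtain k1 where k1: "1 / real (Suc k1) < e"
      using \<open>e > 0\<close> nat_approx_posE by blast
    obtain k2 where k2: "norm x < real k2" using reals_Archimedean2 by blast
    define k where "k = max k1 k2"
    have "1 / real (Suc k) \<le> 1 / real (Suc k1)"
      by (intro divide_left_mono) (auto simp: k_def)
    moreover have "norm x < real k" using k2 by (simp add: k_def)
    ultimately have "x \<in> A k"
      using x e k1 by (auto simp: A_def F_def intro!: less_imp_le[OF e])
    then show "x \<in> (\<Union>k. A k)" by blast
  qed
  ultimately show ?thesis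
    using null_sets_completion_iff2 by blast
qed

text \<open>The Vitali family may be finite or empty. Indices outside its enumeration get radius 0,
  where the open ball is empty but the closed ball is a point; the set \<open>{y. R i > 0}\<close>,
  which is everything or empty, discards that point.\<close>

lemma Vitali_covering_sequence:
  fixes K :: "('a::euclidean_space \<times> real) set"
  assumes "\<And>z R. (z, R) \<in> K \<Longrightarrow> 0 < R \<and> R \<le> M"
  obtains c :: "nat \<Rightarrow> 'a" and R :: "nat \<Rightarrow> real"
  where "\<And>i. R i = 0 \<or> (c i, R i) \<in> K" "disjoint_family (\<lambda>i. cball (c i) (R i) \<inter> {y. R i > 0})"
    "\<And>z r. (z, r) \<in> K \<Longrightarrow> cball z r \<subseteq> (\<Union>i. ball (c i) (5 * R i))"
proof -
  have *: "0 < snd i \<and> snd i \<le> M" if "i \<in> K" for i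
    using assms[of "fst i" "snd i"] that by simp
  obtain C where C: "countable C" "C \<subseteq> K"
     "pairwise (\<lambda>i j. disjnt (cball (fst i) (snd i)) (cball (fst j) (snd j))) C"
     "\<And>i. i \<in> K \<Longrightarrow> \<exists>j. j \<in> C \<and> \<not> disjnt (cball (fst i) (snd i)) (cball (fst j) (snd j)) \<and>
        cball (fst i) (snd i) \<subseteq> ball (fst j) (5 * snd j)"
    by (rule Vitali_covering_lemma_cballs_balls[of K snd M fst, OF *]) blast+
  define f where "f = from_nat_into C"
  define I where "I = to_nat_on C ` C"
  define c where "c i = fst (f i)" for i
  define R where "R i = (if i \<in> I then snd (f i) else 0)" for i
  have fC: "f i \<in> C" if "i \<in> I" for i
    using that C(1) by (auto simp: f_def I_def)
  have finj: "f i \<noteq> f j" if "i \<in> I" "j \<in> I" "i \<noteq> j" for i j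
    using that C(1) by (auto simp: f_def I_def)
  show ?thesis
  proof
    show "R i = 0 \<or> (c i, R i) \<in> K" for i
      using fC[of i] C(2) by (auto simp: R_def c_def)
    show "disjoint_family (\<lambda>i. cball (c i) (R i) \<inter> {y. R i > 0})"
      unfolding disjoint_family_on_def
    proof (intro ballI impI)
      fix i j :: nat assume "i \<noteq> j"
      show "cball (c i) (R i) \<inter> {y. R i > 0} \<inter> (cball (c j) (R j) \<inter> {y. R j > 0}) = {}"
      proof (cases "i \<in> I \<and> j \<in> I")
        case True
        then have "disjnt (cball (c i) (R i)) (cball (c j) (R j))"
          using pairwiseD[OF C(3) fC[of i] fC[of j] finj] \<open>i \<noteq> j\<close> by (simp add: c_def R_def)
        then show ?thesis by (auto simp: disjnt_def)
      qed (auto simp: R_def)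
    qed
    show "cball z r \<subseteq> (\<Union>i. ball (c i) (5 * R i))" if zr: "(z, r) \<in> K" for z r
    proof -
      obtain j where j: "j \<in> C" "cball z r \<subseteq> ball (fst j) (5 * snd j)"
        using C(4)[OF zr] by auto
      define i where "i = to_nat_on C j"
      have "i \<in> I" "f i = j" using j C(1) by (auto simp: i_def I_def f_def)
      then show ?thesis using j(2) by (force simp: c_def R_def)
    qed
  qed
qed

section \<open>Distance to the boundary and the perimeter\<close>

text \<open>A ball is connected, so if it left \<Omega> it would meet the frontier at a distance
  below \<open>bdist \<Omega> x\<close>.\<close>

lemma ball_bdist_subset:
  fixes \<Omega> :: "'a::euclidean_space set"
  assumes "x \<in> \<Omega>"
  shows "ball x (bdist \<Omega> x) \<subseteq> \<Omega>"
proof (rule ccontr)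
  assume "\<not> ball x (bdist \<Omega> x) \<subseteq> \<Omega>"
  then obtain y where y: "y \<in> ball x (bdist \<Omega> x)" "y \<notin> \<Omega>" by blast
  then have "bdist \<Omega> x > 0" using zero_le_dist[of x y] by (auto simp del: zero_le_dist)
  then have "ball x (bdist \<Omega> x) \<inter> frontier \<Omega> \<noteq> {}"
    using y assms centre_in_ball[of x "bdist \<Omega> x"] by (intro connected_Int_frontier) blast+
  then obtain p where "p \<in> frontier \<Omega>" "dist x p < bdist \<Omega> x" by auto
  then show False using infdist_le[of p "frontier \<Omega>" x] by (simp add: bdist_def)
qed

lemma bdist_nonneg: "bdist \<Omega> x \<ge> 0"
  by (simp add: bdist_def infdist_nonneg)

lemma bdist_triangle: "bdist \<Omega> x \<le> bdist \<Omega> y + dist x y"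
  by (simp add: bdist_def infdist_triangle)

lemma continuous_on_bdist [continuous_intros]:
  "continuous_on S f \<Longrightarrow> continuous_on S (\<lambda>x. bdist \<Omega> (f x))"
  by (simp add: bdist_def continuous_on_infdist)

lemma frontier_bounded_nonempty:
  fixes \<Omega> :: "'a::euclidean_space set"
  assumes "bounded \<Omega>" "\<Omega> \<noteq> {}"
  shows "frontier \<Omega> \<noteq> {}"
  using assms not_bounded_UNIV by (auto simp: frontier_eq_empty)

lemma bdist_pos:
  fixes \<Omega> :: "'a::euclidean_space set"
  assumes "open \<Omega>" "bounded \<Omega>" "x \<in> \<Omega>"
  shows "bdist \<Omega> x > 0"
proof -
  have "x \<notin> frontier \<Omega>" using assms by (simp add: frontier_def interior_open)
  then show ?thesis
    unfolding bdist_def using assms frontier_bounded_nonempty[of \<Omega>]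
    by (intro infdist_pos_not_in_closed) auto
qed

text \<open>Frontier points lie in the closure, which has the same diameter.\<close>

lemma bdist_le_diameter:
  fixes \<Omega> :: "'a::euclidean_space set"
  assumes "bounded \<Omega>" "x \<in> \<Omega>"
  shows "bdist \<Omega> x \<le> diameter \<Omega>"
proof -
  obtain p where p: "p \<in> frontier \<Omega>"
    using frontier_bounded_nonempty[of \<Omega>] assms by blast
  have "bdist \<Omega> x \<le> dist x p" unfolding bdist_def by (rule infdist_le[OF p])
  also have "\<dots> \<le> diameter (closure \<Omega>)"
    using assms p closure_subset by (intro diameter_bounded_bound) (auto simp: frontier_def)
  also have "\<dots> = diameter \<Omega>" using assms by (simp add: diameter_closure)
  finally show ?thesis .
qed

text \<open>Over \<open>lborel\<close> the perimeter can be compared with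
  \<open>energy\<close>.\<close>

lemma fractional_perimeter_lborel:
  "fractional_perimeter \<delta> \<tau> U \<Omega> =
     (\<integral>\<^sup>+y. (\<integral>\<^sup>+x. ennreal (\<bar>indicator U x - indicator U y\<bar> / norm (x - y) powr (real CARD('n) + \<delta>))
        * indicator {x \<in> \<Omega>. norm (x - y) < \<tau> * bdist \<Omega> y} x \<partial>lborel) * indicator \<Omega> y \<partial>lborel)"
  for U :: "(real ^ 'n) set"
  unfolding fractional_perimeter_def nn_integral_completion ..

text \<open>Lets a Lebesgue set be replaced by a Borel set: the indicators agree for almost every y
  and, for each such y, for almost every x.\<close>

lemma fractional_perimeter_cong_null:
  assumes N: "N \<in> null_sets lebesgue" and eq: "\<And>x. x \<notin> N \<Longrightarrow> x \<in> U \<longleftrightarrow> x \<in> U'"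
  shows "fractional_perimeter \<delta> \<tau> U \<Omega> = fractional_perimeter \<delta> \<tau> U' \<Omega>"
proof -
  have AE: "AE x in lebesgue. indicator U x = (indicator U' x :: real)"
    using AE_not_in[OF N] by eventually_elim (auto simp: indicator_def eq)
  show ?thesis
    unfolding fractional_perimeter_def
  proof (rule nn_integral_cong_AE, use AE in eventually_elim)
    fix y assume y: "indicator U y = (indicator U' y :: real)"
    show "(\<integral>\<^sup>+x \<in> {x \<in> \<Omega>. norm (x - y) < \<tau> * bdist \<Omega> y}.
         ennreal (\<bar>indicator U x - indicator U y\<bar> / norm (x - y) powr (real CARD('a) + \<delta>)) \<partial>lebesgue) * indicator \<Omega> y
      = (\<integral>\<^sup>+x \<in> {x \<in> \<Omega>. norm (x - y) < \<tau> * bdist \<Omega> y}.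
         ennreal (\<bar>indicator U' x - indicator U' y\<bar> / norm (x - y) powr (real CARD('a) + \<delta>)) \<partial>lebesgue) * indicator \<Omega> y"
      by (intro arg_cong2[where f = "(*)"] refl nn_integral_cong_AE) (use AE in eventually_elim, simp add: y)
  qed
qed

text \<open>Only pairs in \<Omega> enter, and for them the complement separates the same
  pairs.\<close>

lemma fractional_perimeter_Diff:
  "fractional_perimeter \<delta> \<tau> (\<Omega> - U) \<Omega> = fractional_perimeter \<delta> \<tau> U \<Omega>"
  unfolding fractional_perimeter_def
  by (intro nn_integral_cong) (auto simp: indicator_def intro!: nn_integral_cong)

text \<open>The squares of disjoint balls are disjoint, and each lies in the region of integration
  of the perimeter.\<close>

lemma suminf_energy_le_perimeter:
  fixes V \<Omega> :: "(real ^ 'n) set" and c :: "nat \<Rightarrow> real ^ 'n"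
  assumes [measurable]: "V \<in> sets borel" and \<tau>: "0 < \<tau>" "\<tau> < 1"
    and B: "\<And>i. r i > 0 \<Longrightarrow> c i \<in> \<Omega> \<and> r i \<le> \<tau> / 4 * bdist \<Omega> (c i)"
    and disj: "disjoint_family (\<lambda>i. ball (c i) (r i))"
  shows "(\<Sum>i. energy (real CARD('n) + \<delta>) V (ball (c i) (r i))) \<le> fractional_perimeter \<delta> \<tau> V \<Omega>"
proof -
  define G where "G x y = ennreal (\<bar>indicator V x - indicator V y\<bar> / norm (x - y) powr (real CARD('n) + \<delta>))" for x y :: "real ^ 'n"
  have [measurable (raw)]: "(\<lambda>z. G (f z) (h z)) \<in> borel_measurable M"
    if "f \<in> borel_measurable M" "h \<in> borel_measurable M" for f h and M :: "'z measure"
    using that unfolding G_def by measurable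
  have [measurable]: "ball (c i) (r i) \<in> sets borel" for i
    by simp
  let ?S = "\<lambda>y. {x \<in> \<Omega>. norm (x - y) < \<tau> * bdist \<Omega> y}"
  \<comment> \<open>The origin of the factor 1/4: with d the distance at the centre, r \<le> \<tau>
    d / 4 \<le> d / 4 gives \<open>bdist \<Omega> y\<close> at least 3 d / 4, while |x - y| < 2 r
    \<le> \<tau> d / 2.\<close>
  have inB: "x \<in> \<Omega> \<and> y \<in> \<Omega> \<and> norm (x - y) < \<tau> * bdist \<Omega> y" if xy: "x \<in> ball (c i) (r i)" "y \<in> ball (c i) (r i)" for x y i
  proof -
    let ?d = "bdist \<Omega> (c i)"
    have r: "r i > 0" using xy zero_le_dist[of "c i" x] by (auto simp del: zero_le_dist)
    have c: "c i \<in> \<Omega>" "r i \<le> \<tau> / 4 * ?d" using B[OF r] by auto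
    have d: "?d \<ge> 0" by (rule bdist_nonneg)
    have "\<tau> / 4 * ?d \<le> 1 / 4 * ?d" using \<tau> d by (intro mult_right_mono) auto
    then have r4: "r i \<le> ?d / 4" using c by simp
    then have sub: "ball (c i) (r i) \<subseteq> \<Omega>"
      using ball_bdist_subset[OF c(1)] d by auto
    have "?d \<le> bdist \<Omega> y + dist (c i) y" by (rule bdist_triangle)
    then have dy: "?d * (3 / 4) \<le> bdist \<Omega> y" using xy r4 by auto
    have "norm (x - y) \<le> dist (c i) x + dist (c i) y"
      using dist_triangle3[of x y "c i"] by (simp add: dist_norm)
    also have "\<dots> < 2 * r i" using xy by auto
    also have "\<dots> \<le> \<tau> * (?d * (3 / 4))" 
    proof -
      have "0 \<le> \<tau> * ?d" using \<tau> d by simp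
      moreover have "r i \<le> (\<tau> * ?d) / 4" using c by simp
      ultimately have "2 * r i \<le> (\<tau> * ?d) * (3 / 4)" by simp
      then show ?thesis by (simp only: mult.assoc)
    qed
    also have "\<dots> \<le> \<tau> * bdist \<Omega> y" using dy \<tau> by (intro mult_left_mono) auto
    finally show ?thesis using sub xy by auto
  qed
  have pt: "(\<Sum>i. G x y * indicator (ball (c i) (r i)) x * indicator (ball (c i) (r i)) y)
     \<le> G x y * indicator (?S y) x * indicator \<Omega> y" for x y
  proof (cases "\<exists>j. x \<in> ball (c j) (r j) \<and> y \<in> ball (c j) (r j)")
    case True
    then obtain j where j: "x \<in> ball (c j) (r j)" "y \<in> ball (c j) (r j)" by auto
    have "x \<notin> ball (c i) (r i)" if "i \<noteq> j" for i
      using disj j(1) that unfolding disjoint_family_on_def by blast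
    then have "(\<Sum>i. G x y * indicator (ball (c i) (r i)) x * indicator (ball (c i) (r i)) y)
       = (\<Sum>i\<in>{j}. G x y * indicator (ball (c i) (r i)) x * indicator (ball (c i) (r i)) y)"
      by (intro suminf_finite) (auto simp: indicator_def)
    also have "\<dots> = G x y * indicator (?S y) x * indicator \<Omega> y" using inB[OF j] j by simp
    finally show ?thesis by simp
  next
    case False
    then have *: "G x y * indicator (ball (c i) (r i)) x * indicator (ball (c i) (r i)) y = 0" for i
      by (auto simp: indicator_def)
    show ?thesis unfolding * by simp
  qed
  have "(\<Sum>i. energy (real CARD('n) + \<delta>) V (ball (c i) (r i)))
    = (\<integral>\<^sup>+y. \<integral>\<^sup>+x. (\<Sum>i. G x y * indicator (ball (c i) (r i)) x * indicator (ball (c i) (r i)) y) \<partial>lborel \<partial>lborel)"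
    unfolding energy_def G_def[symmetric] by (simp add: nn_integral_suminf)
  also have "\<dots> \<le> (\<integral>\<^sup>+y. (\<integral>\<^sup>+x. G x y * indicator (?S y) x \<partial>lborel) * indicator \<Omega> y \<partial>lborel)"
  proof (rule nn_integral_mono)
    fix y :: "real ^ 'n"
    have "(\<integral>\<^sup>+x. (\<Sum>i. G x y * indicator (ball (c i) (r i)) x * indicator (ball (c i) (r i)) y) \<partial>lborel)
      \<le> (\<integral>\<^sup>+x. G x y * indicator (?S y) x * indicator \<Omega> y \<partial>lborel)"
      by (intro nn_integral_mono pt)
    also have "\<dots> = (\<integral>\<^sup>+x. G x y * indicator (?S y) x \<partial>lborel) * indicator \<Omega> y"
      by (auto simp: indicator_def)
    finally show "(\<integral>\<^sup>+x. (\<Sum>i. G x y * indicator (ball (c i) (r i)) x * indicator (ball (c i) (r i)) y) \<partial>lborel)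
      \<le> (\<integral>\<^sup>+x. G x y * indicator (?S y) x \<partial>lborel) * indicator \<Omega> y" .
  qed
  also have "\<dots> = fractional_perimeter \<delta> \<tau> V \<Omega>"
    unfolding fractional_perimeter_lborel G_def ..
  finally show ?thesis .
qed

text \<open>The sign of \<open>h\<close> tells whether a ball is more or less than half full. If it
  changes at \<open>x\<close> between a small radius and \<open>q x\<close>, then z = x. Otherwise
  it changes along the John curve with radius \<open>q (g t)\<close>, and there the distance to the
  boundary is 4 \<rho> / \<tau>, which turns the John inequality into the last bound.\<close>

lemma John_half_ball:
  fixes \<Omega> V :: "'a::euclidean_space set"
  assumes John: "distance_John_domain s C\<^sub>J x\<^sub>J \<Omega>" and V: "V \<in> sets borel" and \<tau>: "0 < \<tau>" "\<tau> < 1"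
    and thin: "2 * measure lborel (V \<inter> ball x\<^sub>J (\<tau> / 4 * bdist \<Omega> x\<^sub>J))
      \<le> unit_ball_vol DIM('a) * (\<tau> / 4 * bdist \<Omega> x\<^sub>J) ^ DIM('a)"
    and x: "x \<in> \<Omega>" "thick_at V x"
  obtains z \<rho> where "z \<in> \<Omega>" "0 < \<rho>" "\<rho> \<le> \<tau> / 4 * bdist \<Omega> z"
    "2 * measure lborel (V \<inter> ball z \<rho>) = unit_ball_vol DIM('a) * \<rho> ^ DIM('a)"
    "norm (z - x) powr s \<le> 4 * C\<^sub>J / \<tau> * \<rho>"
proof -
  have Om: "open \<Omega>" "bounded \<Omega>" "C\<^sub>J \<ge> 1"
    using John by (auto simp: distance_John_domain_def is_domain_def)
  define h where "h z r = 2 * measure lborel (V \<inter> ball z r) - unit_ball_vol DIM('a) * r ^ DIM('a)" for z r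
  define q where "q z = \<tau> / 4 * bdist \<Omega> z" for z
  have q_pos: "q z > 0" if "z \<in> \<Omega>" for z
    using bdist_pos[OF Om(1,2) that] \<tau> by (simp add: q_def)
  have cont: "continuous_on S (\<lambda>t. h (c t) (r t))"
    if "continuous_on S c" "continuous_on S r" "\<And>t. t \<in> S \<Longrightarrow> r t \<ge> 0" for S :: "real set" and c r
    unfolding h_def by (intro continuous_intros continuous_on_measure_Int_ball V that)
  show ?thesis
  proof (cases "h x (q x) \<le> 0")
    case True
    obtain r0 where r0: "0 < r0" "r0 < q x" "h x r0 \<ge> 0"
      using x(2) q_pos[OF x(1)] unfolding thick_at_def h_def by (metis diff_ge_0_iff_ge)
    obtain \<rho> where \<rho>: "r0 \<le> \<rho>" "\<rho> \<le> q x" "h x \<rho> = 0"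
      using IVT2'[of "h x" "q x" 0 r0] True r0 cont[of "{r0..q x}" "\<lambda>_. x" "\<lambda>t. t"] by auto
    have "4 * C\<^sub>J / \<tau> * \<rho> \<ge> 0" using \<rho> r0 \<tau> Om by simp
    then show ?thesis using \<rho> r0 x by (intro that[of x \<rho>]) (auto simp: q_def h_def)
  next
    case False
    obtain g where g: "path g" "path_image g \<subseteq> \<Omega>" "pathstart g = x" "pathfinish g = x\<^sub>J"
      "\<And>t. t \<in> {0..1} \<Longrightarrow> C\<^sub>J * bdist \<Omega> (g t) > norm (g t - x) powr s"
      using John x(1) unfolding distance_John_domain_def rectifiable_def by metis
    have g\<Omega>: "g t \<in> \<Omega>" if "t \<in> {0..1}" for t using g(2) that by (auto simp: path_image_def)
    have "continuous_on {0..1} (\<lambda>t. h (g t) (q (g t)))"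
      using g(1) unfolding path_def q_def
      by (intro cont continuous_intros) (use q_pos[OF g\<Omega>] in \<open>auto simp: q_def less_imp_le\<close>)
    moreover have "h (g 0) (q (g 0)) \<ge> 0" using False g(3) by (simp add: pathstart_def)
    moreover have "h (g 1) (q (g 1)) \<le> 0" using thin g(4) by (simp add: pathfinish_def h_def q_def)
    ultimately obtain t where t: "0 \<le> t" "t \<le> 1" "h (g t) (q (g t)) = 0"
      using IVT2'[of "\<lambda>t. h (g t) (q (g t))" 1 0 0] by auto
    have "norm (g t - x) powr s \<le> C\<^sub>J * bdist \<Omega> (g t)" using g(5)[of t] t by simp
    also have "\<dots> = 4 * C\<^sub>J / \<tau> * q (g t)" using \<tau> by (simp add: q_def)
    finally show ?thesis
      using t g\<Omega>[of t] q_pos[of "g t"] by (intro that[of "g t" "q (g t)"]) (auto simp: q_def h_def)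
  qed
qed

section \<open>Coverings in John domains\<close>

text \<open>The radii are multiples of \<open>\<rho> powr (1 / s)\<close> for half balls of radius
  \<rho>, so their powers with exponent s (n - \<delta>) are multiples of
  \<open>\<rho> powr (n - \<delta>)\<close>, which \<open>half_ball_energy\<close> controls. The
  uniform bound on the radii serves to compare the measure of the covered set with the sum.\<close>

lemma John_covering:
  fixes \<Omega> V :: "(real ^ 'n) set" and s \<delta> \<tau> C\<^sub>J L :: real
  assumes John: "distance_John_domain s C\<^sub>J x\<^sub>J \<Omega>" and V: "V \<in> sets borel" and \<tau>: "0 < \<tau>" "\<tau> < 1"
    and \<delta>: "0 < \<delta>" "\<delta> < 1" "s * (real CARD('n) - \<delta>) \<le> real CARD('n)"
    and L: "1 \<le> L" "\<And>z. z \<in> \<Omega> \<Longrightarrow> bdist \<Omega> z \<le> L"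
    and thin: "2 * measure lborel (V \<inter> ball x\<^sub>J (\<tau> / 4 * bdist \<Omega> x\<^sub>J))
      \<le> unit_ball_vol (real CARD('n)) * (\<tau> / 4 * bdist \<Omega> x\<^sub>J) ^ CARD('n)"
  obtains x :: "nat \<Rightarrow> real ^ 'n" and r :: "nat \<Rightarrow> real"
  where "\<And>i. 0 \<le> r i" "\<And>i. r i \<le> 20 * L\<^sup>2 * C\<^sub>J / \<tau>"
    "{x \<in> \<Omega>. thick_at V x} \<subseteq> (\<Union>i. ball (x i) (r i))"
    "(\<Sum>i. ennreal (r i powr (s * (real CARD('n) - \<delta>))))
      \<le> ennreal ((20 * L * C\<^sub>J / \<tau>) ^ CARD('n) * half_ball_const TYPE(real ^ 'n) * (1 - \<delta>))
          * fractional_perimeter \<delta> \<tau> V \<Omega>"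
proof -
  let ?n = "CARD('n)"
  have sC: "s \<ge> 1" "C\<^sub>J \<ge> 1"
    using John by (auto simp: distance_John_domain_def)
  \<comment> \<open>The constant of \<open>John_half_ball\<close>, so that
    \<open>cball z (f \<rho>)\<close> reaches every point that led to the half ball at z.\<close>
  define A where "A = 4 * C\<^sub>J / \<tau>"
  have A: "A \<ge> 1" using sC \<tau> by (simp add: A_def field_simps)
  define f where "f \<rho> = L * (A * \<rho>) powr (1 / s)" for \<rho>
  define good where "good z \<rho> \<longleftrightarrow> z \<in> \<Omega> \<and> 0 < \<rho> \<and> \<rho> \<le> \<tau> / 4 * bdist \<Omega> z \<and>
    2 * measure lborel (V \<inter> ball z \<rho>) = unit_ball_vol (real ?n) * \<rho> ^ ?n" for z \<rho>
  have good_le: "\<rho> \<le> L" if "good z \<rho>" for z \<rho>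
  proof -
    have "\<tau> / 4 * bdist \<Omega> z \<le> 1 * L"
      using that \<tau> L by (intro mult_mono) (auto simp: good_def bdist_nonneg)
    then show ?thesis using that by (auto simp: good_def)
  qed
  have powr_le: "v powr (1 / s) \<le> max 1 v" if "v > 0" for v :: real
  proof (cases "v \<ge> 1")
    case True
    then show ?thesis using powr_mono[of "1 / s" 1 v] sC by simp
  next
    case False
    then show ?thesis using powr_mono2[of "1 / s" v 1] sC that by simp
  qed
  have f_pos: "f \<rho> > 0" if "\<rho> > 0" for \<rho> using that L A by (simp add: f_def)
  have f_le: "f \<rho> \<le> A * L\<^sup>2" if "good z \<rho>" for z \<rho>
  proof -
    have \<rho>: "0 < \<rho>" "\<rho> \<le> L" using that good_le by (auto simp: good_def)
    have "A * \<rho> \<le> A * L" using \<rho> A by (intro mult_left_mono) auto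
    moreover have "1 * 1 \<le> A * L" using A L by (intro mult_mono) auto
    ultimately have "max 1 (A * \<rho>) \<le> A * L" by (intro max.boundedI) simp_all
    moreover have "(A * \<rho>) powr (1 / s) \<le> max 1 (A * \<rho>)" using \<rho> A by (intro powr_le) simp
    ultimately have "(A * \<rho>) powr (1 / s) \<le> A * L" by linarith
    then have "f \<rho> \<le> L * (A * L)" using L unfolding f_def by (intro mult_left_mono) auto
    then show ?thesis by (simp add: power2_eq_square mult.left_commute)
  qed
  \<comment> \<open>After rescaling by \<open>L\<close> the radii are at most 1, where passing to the power \<open>1 / s\<close> increases them.\<close>
  have f_ge: "\<rho> \<le> f \<rho>" if "good z \<rho>" for z \<rho>
  proof -
    have \<rho>: "0 < \<rho>" "\<rho> \<le> L" using that good_le by (auto simp: good_def)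
    have "\<rho> / L = (\<rho> / L) powr 1" using \<rho> L by simp
    also have "\<dots> \<le> (\<rho> / L) powr (1 / s)"
      using \<rho> L sC by (intro powr_mono') auto
    also have "\<dots> \<le> (A * \<rho>) powr (1 / s)"
    proof (rule powr_mono2)
      have "\<rho> / L \<le> 1 * \<rho>" using \<rho> L by (simp add: field_simps)
      also have "\<dots> \<le> A * \<rho>" using A \<rho> by (intro mult_right_mono) auto
      finally show "\<rho> / L \<le> A * \<rho>" .
    qed (use \<rho> L sC in auto)
    finally show ?thesis using L by (simp add: f_def field_simps)
  qed
  define K where "K = {(z, R). \<exists>\<rho>. good z \<rho> \<and> R = f \<rho>}"
  have K: "0 < R \<and> R \<le> A * L\<^sup>2" if "(z, R) \<in> K" for z R
    using that f_le f_pos by (auto simp: K_def good_def)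
  obtain c :: "nat \<Rightarrow> real ^ 'n" and R :: "nat \<Rightarrow> real" where cR: "\<And>i. R i = 0 \<or> (c i, R i) \<in> K"
      "disjoint_family (\<lambda>i. cball (c i) (R i) \<inter> {y. R i > 0})"
      "\<And>z r. (z, r) \<in> K \<Longrightarrow> cball z r \<subseteq> (\<Union>i. ball (c i) (5 * R i))"
    by (rule Vitali_covering_sequence[OF K]) (assumption | rule that)+
  have "\<exists>\<rho>. if R i = 0 then \<rho> = 0 else good (c i) \<rho> \<and> R i = f \<rho>" for i
    using cR(1)[of i] by (auto simp: K_def)
  then obtain \<rho> where \<rho>: "\<And>i. if R i = 0 then \<rho> i = 0 else good (c i) (\<rho> i) \<and> R i = f (\<rho> i)"
    by metis
  have R0: "R i \<ge> 0" for i using cR(1)[of i] K[of "c i" "R i"] by auto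
  have \<rho>R: "\<rho> i \<le> R i" for i using \<rho>[of i] f_ge by (auto split: if_splits)
  \<comment> \<open>Since \<rho> is at most \<open>R\<close>, the half balls inherit disjointness
    from the enlarged balls.\<close>
  have disj: "disjoint_family (\<lambda>i. ball (c i) (\<rho> i))"
    unfolding disjoint_family_on_def
  proof (intro ballI impI)
    fix i j :: nat assume "i \<noteq> j"
    have sub: "ball (c i) (\<rho> i) \<subseteq> cball (c i) (R i) \<inter> {y. R i > 0}" for i
    proof (cases "R i = 0")
      case True
      then show ?thesis using \<rho>[of i] by simp
    next
      case False
      then show ?thesis using R0[of i] \<rho>R[of i] by auto
    qed
    have "(cball (c i) (R i) \<inter> {y. R i > 0}) \<inter> (cball (c j) (R j) \<inter> {y. R j > 0}) = {}"
      using cR(2) \<open>i \<noteq> j\<close> unfolding disjoint_family_on_def by blast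
    then show "ball (c i) (\<rho> i) \<inter> ball (c j) (\<rho> j) = {}"
      using sub[of i] sub[of j] by blast
  qed
  let ?e = "s * (real ?n - \<delta>)"
  let ?H = "half_ball_const TYPE(real ^ 'n)"
  have H: "?H > 0" by (rule half_ball_const_pos)
  have summand_le: "ennreal ((5 * R i) powr ?e)
      \<le> ennreal ((5 * L * A) ^ ?n * ?H * (1 - \<delta>)) * energy (real ?n + \<delta>) V (ball (c i) (\<rho> i))" for i
  proof (cases "R i = 0")
    case True
    then show ?thesis by simp
  next
    case False
    then have g: "good (c i) (\<rho> i)" "R i = f (\<rho> i)" using \<rho>[of i] by auto
    have \<rho>0: "\<rho> i > 0" using g by (simp add: good_def)
    have "(5 * R i) powr ?e = (5 * L) powr ?e * (A * \<rho> i) powr (real ?n - \<delta>)"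
      using L A \<rho>0 sC by (simp add: g(2) f_def powr_mult powr_powr)
    also have "\<dots> = (5 * L) powr ?e * A powr (real ?n - \<delta>) * \<rho> i powr (real ?n - \<delta>)"
      using A \<rho>0 by (simp add: powr_mult)
    \<comment> \<open>The bases are at least 1, and both exponents are at most n, the first by the
      bound on s (n - \<delta>). The constant thus becomes independent of \<delta>.\<close>
    also have "\<dots> \<le> (5 * L) powr real ?n * A powr real ?n * \<rho> i powr (real ?n - \<delta>)"
      using L A \<delta> by (intro mult_right_mono mult_mono powr_mono) auto
    also have "\<dots> = (5 * L * A) ^ ?n * \<rho> i powr (real ?n - \<delta>)"
      using L A by (simp add: powr_realpow power_mult_distrib)
    finally have "ennreal ((5 * R i) powr ?e) \<le> ennreal ((5 * L * A) ^ ?n) * ennreal (\<rho> i powr (real ?n - \<delta>))"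
      using L A by (simp add: ennreal_leI flip: ennreal_mult)
    also have "\<dots> \<le> ennreal ((5 * L * A) ^ ?n) * (ennreal (?H * (1 - \<delta>)) * energy (real ?n + \<delta>) V (ball (c i) (\<rho> i)))"
      using half_ball_energy[OF V \<rho>0, of "c i" \<delta>] g(1) \<delta> by (intro mult_left_mono) (auto simp: good_def)
    also have "\<dots> = ennreal ((5 * L * A) ^ ?n * ?H * (1 - \<delta>)) * energy (real ?n + \<delta>) V (ball (c i) (\<rho> i))"
      using L A H \<delta> by (simp add: ennreal_mult mult.assoc)
    finally show ?thesis .
  qed
  have LA: "5 * L * A = 20 * L * C\<^sub>J / \<tau>" "5 * (A * L\<^sup>2) = 20 * L\<^sup>2 * C\<^sub>J / \<tau>" by (simp_all add: A_def)
  show ?thesis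
  proof (rule that[of "\<lambda>i. 5 * R i" c])
    show "0 \<le> 5 * R i" for i using R0 by simp
    have "0 \<le> A * L\<^sup>2" using A by simp
    then have "R i \<le> A * L\<^sup>2" for i using cR(1)[of i] K[of "c i" "R i"] by auto
    then show "5 * R i \<le> 20 * L\<^sup>2 * C\<^sub>J / \<tau>" for i unfolding LA(2)[symmetric] by (intro mult_left_mono) auto
    show "{x \<in> \<Omega>. thick_at V x} \<subseteq> (\<Union>i. ball (c i) (5 * R i))"
    proof
      fix y assume "y \<in> {x \<in> \<Omega>. thick_at V x}"
      then obtain z \<rho>' where z: "z \<in> \<Omega>" "0 < \<rho>'" "\<rho>' \<le> \<tau> / 4 * bdist \<Omega> z"
        "2 * measure lborel (V \<inter> ball z \<rho>') = unit_ball_vol (real ?n) * \<rho>' ^ ?n"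
        "norm (z - y) powr s \<le> A * \<rho>'"
        using John_half_ball[OF John V \<tau>, of y] thin by (auto simp: A_def)
      have "norm (z - y) = (norm (z - y) powr s) powr (1 / s)" using sC by (simp add: powr_powr)
      also have "\<dots> \<le> (A * \<rho>') powr (1 / s)" using z sC by (intro powr_mono2) auto
      also have "\<dots> \<le> f \<rho>'" unfolding f_def
        using mult_right_mono[OF L(1), of "(A * \<rho>') powr (1 / s)"] by simp
      finally have "y \<in> cball z (f \<rho>')" by (simp add: dist_norm)
      moreover have "(z, f \<rho>') \<in> K" using z by (auto simp: K_def good_def)
      ultimately show "y \<in> (\<Union>i. ball (c i) (5 * R i))" using cR(3) by blast
    qed
    have "(\<Sum>i. ennreal ((5 * R i) powr ?e))
       \<le> (\<Sum>i. ennreal ((5 * L * A) ^ ?n * ?H * (1 - \<delta>)) * energy (real ?n + \<delta>) V (ball (c i) (\<rho> i)))"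
      by (intro suminf_le summand_le) auto
    also have "\<dots> = ennreal ((5 * L * A) ^ ?n * ?H * (1 - \<delta>)) * (\<Sum>i. energy (real ?n + \<delta>) V (ball (c i) (\<rho> i)))"
      by (rule ennreal_suminf_cmult)
    also have "\<dots> \<le> ennreal ((5 * L * A) ^ ?n * ?H * (1 - \<delta>)) * fractional_perimeter \<delta> \<tau> V \<Omega>"
    proof (intro mult_left_mono suminf_energy_le_perimeter V \<tau> disj)
      show "c i \<in> \<Omega> \<and> \<rho> i \<le> \<tau> / 4 * bdist \<Omega> (c i)" if "0 < \<rho> i" for i
        using \<rho>[of i] that by (auto simp: good_def split: if_splits)
    qed auto
    finally show "(\<Sum>i. ennreal ((5 * R i) powr ?e))
      \<le> ennreal ((20 * L * C\<^sub>J / \<tau>) ^ ?n * ?H * (1 - \<delta>)) * fractional_perimeter \<delta> \<tau> V \<Omega>"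
      unfolding LA .
  qed
qed

text \<open>Some point is farther than a third of the diameter from the center, as otherwise the
  diameter would be at most two thirds of itself. The John condition of its curve at t = 1 is the
  bound, which later keeps the measure of \<Omega> away from 0.\<close>

lemma John_center_bdist_ge:
  fixes \<Omega> :: "'a::euclidean_space set"
  assumes John: "distance_John_domain s C\<^sub>J x\<^sub>J \<Omega>"
  shows "(diameter \<Omega> / 3) powr s / C\<^sub>J \<le> bdist \<Omega> x\<^sub>J" "diameter \<Omega> > 0"
proof -
  have Om: "open \<Omega>" "bounded \<Omega>" "C\<^sub>J \<ge> 1" "s \<ge> 1" "x\<^sub>J \<in> \<Omega>"
    using John by (auto simp: distance_John_domain_def is_domain_def)
  show D: "diameter \<Omega> > 0"
    using bdist_pos[OF Om(1,2,5)] bdist_le_diameter[OF Om(2,5)] by linarith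
  have "\<exists>x\<in>\<Omega>. norm (x - x\<^sub>J) > diameter \<Omega> / 3"
  proof (rule ccontr)
    assume "\<not> ?thesis"
    then have near: "norm (x - x\<^sub>J) \<le> diameter \<Omega> / 3" if "x \<in> \<Omega>" for x using that by force
    have "norm (x - y) \<le> 2 * diameter \<Omega> / 3" if "x \<in> \<Omega>" "y \<in> \<Omega>" for x y
      using near[OF that(1)] near[OF that(2)] norm_triangle_ineq4[of "x - x\<^sub>J" "y - x\<^sub>J"] by simp
    then have "diameter \<Omega> \<le> 2 * diameter \<Omega> / 3" using D by (intro diameter_le) auto
    then show False using D by simp
  qed
  then obtain x where x: "x \<in> \<Omega>" "norm (x - x\<^sub>J) > diameter \<Omega> / 3" by blast
  then obtain g where g: "pathfinish g = x\<^sub>J" "\<And>t. t \<in> {0..1} \<Longrightarrow> C\<^sub>J * bdist \<Omega> (g t) > norm (g t - x) powr s"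
    using John unfolding distance_John_domain_def by metis
  have "(diameter \<Omega> / 3) powr s \<le> norm (x - x\<^sub>J) powr s"
    using x D Om by (intro powr_mono2) auto
  also have "\<dots> \<le> C\<^sub>J * bdist \<Omega> x\<^sub>J"
    using g(2)[of 1] g(1) by (simp add: pathfinish_def norm_minus_commute)
  finally show "(diameter \<Omega> / 3) powr s / C\<^sub>J \<le> bdist \<Omega> x\<^sub>J"
    using Om by (simp add: field_simps)
qed

text \<open>Open sets are treated apart because for them not even a null set may be lost.\<close>

lemma lebesgue_set_borel_subset:
  fixes U :: "'a::euclidean_space set"
  assumes "U \<in> sets lebesgue"
  obtains U' where "U' \<in> sets borel" "U' \<subseteq> U" "U - U' \<in> null_sets lebesgue" "open U \<Longrightarrow> U' = U"
proof (cases "open U")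
  case True
  then show ?thesis by (intro that[of U]) auto
next
  case False
  obtain S N N' where "U = S \<union> N" "N \<subseteq> N'" "N' \<in> null_sets lborel" "S \<in> sets lborel"
    using sets_completionE[OF assms] .
  then show ?thesis
    using False null_sets_completion_iff2[of "U - S" lborel] by (intro that[of S]) auto
qed

text \<open>Subadditivity, together with \<open>r ^ n = r powr (n - e) * r powr e\<close>, where the
  first factor is at most \<open>M ^ n\<close>.\<close>

lemma emeasure_le_suminf_balls:
  fixes W :: "'a::euclidean_space set"
  assumes W: "W \<in> sets borel" and N: "N \<in> null_sets lebesgue"
    and cov: "W - N \<subseteq> (\<Union>i. ball (x i) (r i))" and r: "\<And>i. 0 \<le> r i" "\<And>i. r i \<le> M"
    and M: "1 \<le> M" and e: "0 < e" "e \<le> real DIM('a)"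
  shows "emeasure lborel W \<le> ennreal (unit_ball_vol DIM('a) * M ^ DIM('a)) * (\<Sum>i::nat. ennreal (r i powr e))"
proof -
  let ?n = "DIM('a)"
  have "emeasure lborel W = emeasure lebesgue (W - N)"
    using W N by (simp add: emeasure_Diff_null_set)
  also have "\<dots> \<le> emeasure lebesgue (\<Union>i. ball (x i) (r i))"
    by (rule emeasure_mono[OF cov]) auto
  also have "\<dots> \<le> (\<Sum>i. emeasure lebesgue (ball (x i) (r i)))"
    by (intro emeasure_subadditive_countably) auto
  also have "\<dots> \<le> (\<Sum>i. ennreal (unit_ball_vol ?n * M ^ ?n) * ennreal (r i powr e))"
  proof (intro suminf_le)
    fix i
    have "r i ^ ?n \<le> M ^ ?n * r i powr e"
    proof (cases "r i = 0")
      case False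
      then have r0: "r i > 0" using r(1)[of i] by linarith
      have "r i ^ ?n = r i powr (?n - e) * r i powr e"
        using r0 by (simp flip: powr_add powr_realpow)
      also have "r i powr (?n - e) \<le> M powr (?n - e)"
        using r r0 e by (intro powr_mono2) auto
      also have "\<dots> \<le> M powr ?n" using M e by (intro powr_mono) auto
      also have "\<dots> = M ^ ?n" using M by (simp add: powr_realpow)
      finally show ?thesis by (simp add: mult_right_mono)
    qed (simp add: power_0_left)
    then have "unit_ball_vol ?n * r i ^ ?n \<le> unit_ball_vol ?n * (M ^ ?n * r i powr e)"
      by (intro mult_left_mono) auto
    then show "emeasure lebesgue (ball (x i) (r i)) \<le> ennreal (unit_ball_vol ?n * M ^ ?n) * ennreal (r i powr e)"
      using r(1)[of i] M by (simp add: emeasure_ball mult.assoc ennreal_leI flip: ennreal_mult)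
  qed auto
  finally show ?thesis by simp
qed

lemma measure_Diff_le_half:
  fixes \<Omega> U :: "'a::euclidean_space set"
  assumes [measurable]: "\<Omega> \<in> sets borel" "U \<in> sets borel" and sub: "ball z \<rho> \<subseteq> \<Omega>" and "\<rho> \<ge> 0"
    and thick: "\<not> 2 * measure lborel (U \<inter> ball z \<rho>) \<le> unit_ball_vol DIM('a) * \<rho> ^ DIM('a)"
  shows "2 * measure lborel ((\<Omega> - U) \<inter> ball z \<rho>) \<le> unit_ball_vol DIM('a) * \<rho> ^ DIM('a)"
proof -
  have "(\<Omega> - U) \<inter> ball z \<rho> = ball z \<rho> - (U \<inter> ball z \<rho>)" using sub by auto
  also have "measure lborel \<dots> = measure lborel (ball z \<rho>) - measure lborel (U \<inter> ball z \<rho>)"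
    using emeasure_lborel_ball_finite[of z \<rho>] by (intro measure_Diff) auto
  finally show ?thesis using thick \<open>\<rho> \<ge> 0\<close> by (simp add: content_ball)
qed

text \<open>\<open>C\<close> is chosen before \<delta>, \<Omega>, \<open>x\<^sub>J\<close> and
  \<open>U\<close>, and \<open>D\<close> fixes the diameter; this order of quantifiers expresses
  what the constant depends on. A radius 0 stands for an empty ball, so finite coverings are
  included.\<close>

theorem theorem1p1:
  fixes \<tau> s \<gamma> C\<^sub>J D :: real
  assumes "CARD('n::finite) \<ge> 2"
    and "0 < \<tau>" "\<tau> < 1" "0 < \<gamma>" "\<gamma> < 1" "1 \<le> s" "1 \<le> C\<^sub>J"
  shows "\<exists>C>0. \<forall>(\<delta>::real) (\<Omega> :: (real ^ 'n) set) x\<^sub>J U.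
    0 < \<delta> \<and> \<delta> < 1 \<and> s \<le> real CARD('n) / (real CARD('n) - \<delta>) \<and>
    distance_John_domain s C\<^sub>J x\<^sub>J \<Omega> \<and> diameter \<Omega> = D \<and>
    U \<in> sets lebesgue \<and> U \<subseteq> \<Omega> \<and> measure lebesgue U / measure lebesgue \<Omega> \<le> \<gamma> \<longrightarrow>
    (\<exists>N\<in>null_sets lebesgue. (open U \<longrightarrow> N = {}) \<and>
      (\<exists>(x :: nat \<Rightarrow> real ^ 'n) (r :: nat \<Rightarrow> real).
        (\<forall>i. r i \<ge> 0) \<and> U - N \<subseteq> (\<Union>i. ball (x i) (r i)) \<and>
        (\<Sum>i. ennreal (r i powr (s * (real CARD('n) - \<delta>))))
          \<le> ennreal (C * (1 - \<delta>)) * fractional_perimeter \<delta> \<tau> U \<Omega>))"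
proof -
  let ?n = "CARD('n)"
  define L where "L = max 1 D"
  define C1 where "C1 = (20 * L * C\<^sub>J / \<tau>) ^ ?n * half_ball_const TYPE(real ^ 'n)"
  define M where "M = 20 * L\<^sup>2 * C\<^sub>J / \<tau>"
  define d0 where "d0 = (D / 3) powr s / C\<^sub>J"
  define w where "w = unit_ball_vol (real ?n)"
  \<comment> \<open>The numerator bounds the power of the radius L + 1 of a single ball, the
    denominator is a lower bound for the measure of \<Omega> - U, and the last factor comes from
    bounding that measure by the perimeter.\<close>
  define C2 where "C2 = (L + 1) ^ ?n / ((1 - \<gamma>) * (w * d0 ^ ?n)) * (w * M ^ ?n * C1)"
  have L: "L \<ge> 1" "D \<le> L" by (auto simp: L_def)
  have w: "w > 0" by (simp add: w_def)
  have C1: "C1 > 0"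
    unfolding C1_def using L assms by (intro mult_pos_pos zero_less_power half_ball_const_pos) auto
  have M: "M \<ge> 1"
  proof -
    have "1 * 1 \<le> L\<^sup>2 * C\<^sub>J" using L assms by (intro mult_mono one_le_power) auto
    then show ?thesis using assms by (simp add: M_def field_simps)
  qed
  \<comment> \<open>\<open>D\<close> is still an arbitrary real, so \<open>d0\<close> may be 0 and
    the quotient in \<open>C2\<close> a division by 0, with value 0. Positivity of the final
    constant comes from \<open>C1\<close>.\<close>
  have d0: "d0 \<ge> 0" using assms by (simp add: d0_def)
  have C2: "C2 \<ge> 0" using L M C1 w d0 assms by (simp add: C2_def)
  show ?thesis
  proof (intro exI[of _ "C1 + C2"] conjI allI impI, goal_cases)
    case 1
    show ?case using C1 C2 by simp
  next
    case (2 \<delta> \<Omega> x\<^sub>J U)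
    then have \<delta>: "0 < \<delta>" "\<delta> < 1" and s: "s \<le> real ?n / (real ?n - \<delta>)"
      and John: "distance_John_domain s C\<^sub>J x\<^sub>J \<Omega>" and D: "diameter \<Omega> = D"
      and U: "U \<in> sets lebesgue" "U \<subseteq> \<Omega>" "measure lebesgue U / measure lebesgue \<Omega> \<le> \<gamma>"
      by auto
    define e where "e = s * (real ?n - \<delta>)"
    have "2 \<le> real ?n" using assms(1) by linarith
    then have "real ?n - \<delta> > 0" using \<delta> by linarith
    then have e: "0 < e" "e \<le> real ?n"
      using s assms by (simp_all add: e_def pos_le_divide_eq)
    have Om: "open \<Omega>" "bounded \<Omega>" "x\<^sub>J \<in> \<Omega>"
      using John by (auto simp: distance_John_domain_def is_domain_def)
    have D0: "D > 0" and bd0: "d0 \<le> bdist \<Omega> x\<^sub>J"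
      using John_center_bdist_ge[OF John] D by (auto simp: d0_def)
    have d0: "d0 > 0" using D0 assms by (simp add: d0_def)
    have bdL: "bdist \<Omega> z \<le> L" if "z \<in> \<Omega>" for z
      using bdist_le_diameter[OF Om(2) that] D L by simp
    obtain U' where U': "U' \<in> sets borel" "U' \<subseteq> U" "U - U' \<in> null_sets lebesgue" "open U \<Longrightarrow> U' = U"
      using lebesgue_set_borel_subset[OF U(1)] by blast
    have P: "fractional_perimeter \<delta> \<tau> U' \<Omega> = fractional_perimeter \<delta> \<tau> U \<Omega>"
      using U'(2) by (intro fractional_perimeter_cong_null[OF U'(3)]) auto
    \<comment> \<open>First what is lost in passing to the Borel set \<open>U'\<close>, then its
      thin points; both are empty for open \<open>U\<close>.\<close>
    define N where "N = (U - U') \<union> {x \<in> U'. \<not> thick_at U' x}"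
    have N: "N \<in> null_sets lebesgue"
      unfolding N_def by (intro null_sets.Un U' null_sets_thin_points)
    have N_open: "open U \<Longrightarrow> N = {}"
      using U'(4) thick_at_open[of U] by (auto simp: N_def)
    let ?\<rho> = "\<tau> / 4 * bdist \<Omega> x\<^sub>J"
    have goal: ?case
      if "\<And>i. 0 \<le> r i" "U - N \<subseteq> (\<Union>i. ball (x i) (r i))"
        "(\<Sum>i. ennreal (r i powr e)) \<le> ennreal (C' * (1 - \<delta>)) * fractional_perimeter \<delta> \<tau> U \<Omega>" "C' \<le> C1 + C2"
      for x :: "nat \<Rightarrow> real ^ 'n" and r C'
    proof (rule bexI[OF _ N], rule conjI, rule impI, erule N_open, rule exI[of _ x], rule exI[of _ r], intro conjI allI)
      have "ennreal (C' * (1 - \<delta>)) * fractional_perimeter \<delta> \<tau> U \<Omega>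
        \<le> ennreal ((C1 + C2) * (1 - \<delta>)) * fractional_perimeter \<delta> \<tau> U \<Omega>"
        using that(4) \<delta> by (intro mult_right_mono ennreal_leI) auto
      then show "(\<Sum>i. ennreal (r i powr (s * (real ?n - \<delta>))))
          \<le> ennreal ((C1 + C2) * (1 - \<delta>)) * fractional_perimeter \<delta> \<tau> U \<Omega>"
        by (rule order_trans[OF that(3)[unfolded e_def]])
    qed (fact that)+
    show ?case
    proof (cases "2 * measure lborel (U' \<inter> ball x\<^sub>J ?\<rho>) \<le> unit_ball_vol (real ?n) * ?\<rho> ^ ?n")
      case True
      obtain x :: "nat \<Rightarrow> real ^ 'n" and r where xr: "\<And>i. 0 \<le> r i" "\<And>i. r i \<le> M"
        "{x \<in> \<Omega>. thick_at U' x} \<subseteq> (\<Union>i. ball (x i) (r i))"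
        "(\<Sum>i. ennreal (r i powr e)) \<le> ennreal (C1 * (1 - \<delta>)) * fractional_perimeter \<delta> \<tau> U' \<Omega>"
        by (rule John_covering[OF John U'(1) assms(2,3) \<delta> e(2)[unfolded e_def] L(1) bdL True,
              folded e_def C1_def M_def]) (assumption | rule that)+
      have "U - N \<subseteq> (\<Union>i. ball (x i) (r i))"
        using xr(3) U(2) U'(2) by (auto simp: N_def)
      then show ?thesis using xr C2 by (intro goal[of r x C1]) (auto simp: P)
    next
      case False
      \<comment> \<open>The center ball is more than half full, so at most half of it belongs to
        \<open>W\<close>. The covering of \<open>W\<close> serves only to bound its measure by the
        perimeter.\<close>
      define W where "W = \<Omega> - U'"
      have W: "W \<in> sets borel" using U' Om by (auto simp: W_def)
      have \<rho>: "0 \<le> ?\<rho>" "?\<rho> \<le> bdist \<Omega> x\<^sub>J"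
        using assms bdist_nonneg[of \<Omega> x\<^sub>J] mult_right_mono[of "\<tau> / 4" 1 "bdist \<Omega> x\<^sub>J"] by auto
      then have "ball x\<^sub>J ?\<rho> \<subseteq> \<Omega>" using ball_bdist_subset[OF Om(3)] by (meson subset_ball subset_trans)
      then have thin: "2 * measure lborel (W \<inter> ball x\<^sub>J ?\<rho>) \<le> unit_ball_vol (real ?n) * ?\<rho> ^ ?n"
        using measure_Diff_le_half[of \<Omega> U' x\<^sub>J ?\<rho>] False U'(1) Om(1) \<rho>(1) by (simp add: W_def)
      obtain x :: "nat \<Rightarrow> real ^ 'n" and r where xr: "\<And>i. 0 \<le> r i" "\<And>i. r i \<le> M"
        "{x \<in> \<Omega>. thick_at W x} \<subseteq> (\<Union>i. ball (x i) (r i))"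
        "(\<Sum>i. ennreal (r i powr e)) \<le> ennreal (C1 * (1 - \<delta>)) * fractional_perimeter \<delta> \<tau> W \<Omega>"
        by (rule John_covering[OF John W assms(2,3) \<delta> e(2)[unfolded e_def] L(1) bdL thin,
              folded e_def C1_def M_def]) (assumption | rule that)+
      have PW: "fractional_perimeter \<delta> \<tau> W \<Omega> = fractional_perimeter \<delta> \<tau> U \<Omega>"
        unfolding W_def fractional_perimeter_Diff P ..
      have "W - {x \<in> W. \<not> thick_at W x} \<subseteq> (\<Union>i. ball (x i) (r i))"
        using xr(3) by (auto simp: W_def)
      then have "emeasure lborel W \<le> ennreal (w * M ^ ?n) * (\<Sum>i. ennreal (r i powr e))"
        using emeasure_le_suminf_balls[OF W null_sets_thin_points[OF W] _ xr(1,2) M] e by (simp add: w_def)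
      also have "\<dots> \<le> ennreal (w * M ^ ?n) * (ennreal (C1 * (1 - \<delta>)) * fractional_perimeter \<delta> \<tau> U \<Omega>)"
        using xr(4) unfolding PW by (intro mult_left_mono) auto
      finally have upper: "emeasure lborel W \<le> \<dots>" .
      have fin: "\<Omega> \<in> lmeasurable" using Om lmeasurable_open by blast
      have ball: "measure lebesgue (ball x\<^sub>J (bdist \<Omega> x\<^sub>J)) \<le> measure lebesgue \<Omega>"
        using ball_bdist_subset[OF Om(3)] fin by (intro measure_mono_fmeasurable) auto
      have "w * d0 ^ ?n \<le> w * bdist \<Omega> x\<^sub>J ^ ?n"
        using d0 bd0 w by (intro mult_left_mono power_mono) auto
      also have "\<dots> = measure lebesgue (ball x\<^sub>J (bdist \<Omega> x\<^sub>J))"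
        by (simp add: content_ball bdist_nonneg w_def)
      also note ball
      finally have vol: "w * d0 ^ ?n \<le> measure lebesgue \<Omega>" .
      have vol0: "measure lebesgue \<Omega> > 0"
        using vol w d0 by (smt (verit) mult_pos_pos zero_less_power)
      have Ufin: "U \<in> lmeasurable" using fmeasurableI2[OF fin U(2)] U(1) by simp
      \<comment> \<open>The bound by \<gamma> passes to \<open>U'\<close> and leaves
        \<open>W\<close> at least the fraction 1 - \<gamma> of \<Omega>, which contains a ball of
        radius \<open>d0\<close>.\<close>
      have "measure lebesgue U' \<le> measure lebesgue U"
        using U' Ufin by (intro measure_mono_fmeasurable) auto
      also have "\<dots> \<le> \<gamma> * measure lebesgue \<Omega>" using U(3) vol0 by (simp add: field_simps)
      finally have mU': "measure lebesgue U' \<le> \<gamma> * measure lebesgue \<Omega>" .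
      have Wfin: "W \<in> lmeasurable" using fmeasurableI2[OF fin, of W] W by (auto simp: W_def)
      have "measure lebesgue W = measure lebesgue \<Omega> - measure lebesgue U'"
        unfolding W_def using fmeasurableD[OF fin] fmeasurableD2[OF fin] U' U(2)
        by (intro measure_Diff) simp_all
      then have "(1 - \<gamma>) * measure lebesgue \<Omega> \<le> measure lebesgue W"
        using mU' by (simp add: algebra_simps)
      moreover have "(1 - \<gamma>) * (w * d0 ^ ?n) \<le> (1 - \<gamma>) * measure lebesgue \<Omega>"
        using vol assms by (intro mult_left_mono) auto
      ultimately have "ennreal ((1 - \<gamma>) * (w * d0 ^ ?n)) \<le> emeasure lebesgue W"
        using emeasure_eq_measure2[OF Wfin] by (simp add: ennreal_leI)
      also have "\<dots> = emeasure lborel W" using W by simp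
      finally have le: "ennreal ((1 - \<gamma>) * (w * d0 ^ ?n))
          \<le> ennreal (w * M ^ ?n) * (ennreal (C1 * (1 - \<delta>)) * fractional_perimeter \<delta> \<tau> U \<Omega>)"
        using upper by (rule order_trans)
      \<comment> \<open>Scales the lower bound for the measure of \<open>W\<close> to
        \<open>(L + 1) ^ n\<close>, which dominates the one term of the sum.\<close>
      define k where "k = (L + 1) ^ ?n / ((1 - \<gamma>) * (w * d0 ^ ?n))"
      have k: "k > 0" "k * ((1 - \<gamma>) * (w * d0 ^ ?n)) = (L + 1) ^ ?n"
        using L w d0 assms by (auto simp: k_def)
      have "(L + 1) powr e \<le> (L + 1) powr real ?n" using L e by (intro powr_mono) auto
      also have "\<dots> = (L + 1) ^ ?n" using L by (simp add: powr_realpow)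
      finally have "ennreal ((L + 1) powr e) \<le> ennreal k * ennreal ((1 - \<gamma>) * (w * d0 ^ ?n))"
        using k by (simp add: ennreal_leI flip: ennreal_mult')
      also have "\<dots> \<le> ennreal k * (ennreal (w * M ^ ?n) * (ennreal (C1 * (1 - \<delta>)) * fractional_perimeter \<delta> \<tau> U \<Omega>))"
        by (intro mult_left_mono le) auto
      also have "\<dots> = ennreal (k * (w * M ^ ?n) * (C1 * (1 - \<delta>))) * fractional_perimeter \<delta> \<tau> U \<Omega>"
        using k w M C1 \<delta> by (simp add: ennreal_mult mult.assoc)
      also have "k * (w * M ^ ?n) * (C1 * (1 - \<delta>)) = C2 * (1 - \<delta>)"
        by (simp add: C2_def k_def)
      finally have one: "ennreal ((L + 1) powr e) \<le> ennreal (C2 * (1 - \<delta>)) * fractional_perimeter \<delta> \<tau> U \<Omega>" .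
      \<comment> \<open>An open ball of radius L + 1, larger than the diameter, about the center
        contains \<Omega>; all other terms vanish because \<open>0 powr e = 0\<close>.\<close>
      define r' where "r' i = (if i = 0 then L + 1 else 0)" for i :: nat
      have "(\<Sum>i. ennreal (r' i powr e)) = (\<Sum>i\<in>{0}. ennreal (r' i powr e))"
        by (rule suminf_finite) (auto simp: r'_def)
      then have sum: "(\<Sum>i. ennreal (r' i powr e)) = ennreal ((L + 1) powr e)" by (simp add: r'_def)
      have "U - N \<subseteq> ball x\<^sub>J (r' 0)"
      proof
        fix y assume "y \<in> U - N"
        then have "dist x\<^sub>J y \<le> diameter \<Omega>"
          using U(2) Om by (intro diameter_bounded_bound) auto
        then show "y \<in> ball x\<^sub>J (r' 0)" using D L by (simp add: r'_def)
      qed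
      then show ?thesis
        using one sum L C1 by (intro goal[of r' "\<lambda>_. x\<^sub>J" C2]) (auto simp: r'_def)
    qed
  qed
qed

end
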